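(* Let $(E,A,B,Q,S,R)\in\Sigma^w_{m,n}(\mathbb K)$ with Popov function $\Phi(z)\in\mathbb K(z)^{m\times m}$ and system space $\mathcal V_{(E,A,B)}$. (a) If there exists $P\in\mathbb K^{n\times n}$ that is a solution of the KYP inequality $\mathcal M(P)\succeq_{\mathcal V_{(E,A,B)}}0$, $P=P^*$, then $\Phi(e^{i\omega})\succeq 0$ for all $\omega\in\mathbb R$ with $\det(e^{i\omega}E-A)\neq 0$. (b) If, on the other hand, $(E,A,B)$ is R-controllable and $\Phi(e^{i\omega})\succeq 0$ for all $\omega\in\mathbb R$ with $\det(e^{i\omega}E-A)\neq 0$, then there exists a solution $P\in\mathbb K^{n\times n}$ of the KYP inequality $\mathcal M(P)\succeq_{\mathcal V_{(E,A,B)}}0$, $P=P^*$.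
   Context: $\mathbb K\in\{\mathbb R,\mathbb C\}$. $\Sigma_{m,n}(\mathbb K)$ is the set of triples $(E,A,B)\in\mathbb K^{n\times n}\times\mathbb K^{n\times n}\times\mathbb K^{n\times m}$ such that the pencil $zE-A$ is regular, i.e. $\det(zE-A)\not\equiv 0$. $\Sigma^w_{m,n}(\mathbb K)$ is the set of $(E,A,B,Q,S,R)$ with $(E,A,B)\in\Sigma_{m,n}(\mathbb K)$, $Q=Q^*\in\mathbb K^{n\times n}$, $S\in\mathbb K^{n\times m}$, $R=R^*\in\mathbb K^{m\times m}$. The behavior $\mathfrak B_{(E,A,B)}$ is the set of all pairs of sequences $(x,u)\in(\mathbb K^n)^{\mathbb N_0}\times(\mathbb K^m)^{\mathbb N_0}$ with $Ex_{j+1}=Ax_j+Bu_j$ for all $j\in\mathbb N_0$. The system space $\mathcal V_{(E,A,B)}$ is the smallest subspace of $\mathbb K^{n+m}$ containing $\begin{pmatrix}x_j\\ u_j\end{pmatrix}$ for all $j\in\mathbb N_0$ and all $(x,u)\in\mathfrak B_{(E,A,B)}$. For a subspace $\mathcal V\subseteq\mathbb K^{n+m}$ and a Hermitian matrix $M$, $M\succeq_{\mathcal V}0$ means $V^*MV\succeq0$ for any matrix $V$ whose columns form a basis of $\mathcal V$. $\mathcal W_{(E,A,B)}$ is the set of all $x^0\in\mathbb K^n$ for which there is $(x,u)\in\mathfrak B_{(E,A,B)}$ with $Ex_0=Ex^0$. The system is R-controllable if for all $x^0,x^{\rm f}\in\mathcal W_{(E,A,B)}$ there exist $(x,u)\in\mathfrak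 B_{(E,A,B)}$ and $j_{\rm f}\in\mathbb N_0$ with $Ex_0=Ex^0$ and $Ex_{j_{\rm f}}=Ex^{\rm f}$; equivalently, $\operatorname{rk}\begin{bmatrix}\lambda E-A & B\end{bmatrix}=n$ for all $\lambda\in\mathbb C$. For a Hermitian $P\in\mathbb K^{n\times n}$, $$\mathcal M(P)=\begin{bmatrix}A^*PA-E^*PE+Q & A^*PB+S\\ B^*PA+S^* & B^*PB+R\end{bmatrix}.$$ The Popov function is $$\Phi(z)=\begin{bmatrix}(zE-A)^{-1}B\\ I_m\end{bmatrix}^{\sim}\begin{bmatrix}Q&S\\ S^*&R\end{bmatrix}\begin{bmatrix}(zE-A)^{-1}B\\ I_m\end{bmatrix},$$ where $G^\sim(z)=G(\overline z^{\,-1})^*$ for a rational matrix $G(z)$. *)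

theory Defs
  imports "HOL-Analysis.Analysis" "HOL-Computational_Algebra.Polynomial"
begin

text \<open>
  The scalar field is either the reals or the complex numbers. The class has exactly these two models
  up to isomorphism (see \<open>range_to_complex\<close> below): \<open>to_complex\<close> is an isometric field embedding over
  the reals, so its range is a field between the reals and the complex numbers. For the reals,
  \<open>conjg\<close> is the identity.
\<close>

class real_or_complex = real_normed_field + euclidean_space +
  fixes conjg :: "'a \<Rightarrow> 'a"
    and to_complex :: "'a \<Rightarrow> complex"
  assumes to_complex_add: "to_complex (x + y) = to_complex x + to_complex y"
    and to_complex_mult: "to_complex (x * y) = to_complex x * to_complex y"
    and to_complex_one: "to_complex 1 = 1"
    and to_complex_scaleR: "to_complex (r *\<^sub>R x) = r *\<^sub>R to_complex x"
    and norm_to_complex: "norm (to_complex x) = norm x"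
    and to_complex_conjg: "to_complex (conjg x) = cnj (to_complex x)"

instantiation real :: real_or_complex
begin

definition conjg_real :: "real \<Rightarrow> real" where "conjg_real x = x"
definition to_complex_real :: "real \<Rightarrow> complex" where "to_complex_real x = complex_of_real x"

instance
  by standard (simp_all add: conjg_real_def to_complex_real_def scaleR_conv_of_real)

end

instantiation complex :: real_or_complex
begin

definition conjg_complex :: "complex \<Rightarrow> complex" where "conjg_complex z = cnj z"
definition to_complex_complex :: "complex \<Rightarrow> complex" where "to_complex_complex z = z"

instance
  by standard (simp_all only: conjg_complex_def to_complex_complex_def)

end

lemma to_complex_of_real:
  "to_complex (of_real r :: 'k::real_or_complex) = of_real r"
  by (simp add: of_real_def to_complex_scaleR to_complex_one)

lemma inj_to_complex: "inj (to_complex :: 'k::real_or_complex \<Rightarrow> complex)"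
proof (rule injI)
  fix x y :: 'k
  assume eq: "to_complex x = to_complex y"
  have "to_complex x = to_complex (x - y) + to_complex y"
    by (metis to_complex_add diff_add_cancel)
  then have "norm (x - y) = 0"
    using eq by (metis add_cancel_left_left norm_to_complex norm_zero)
  then show "x = y" by (simp only: norm_eq_zero right_minus_eq)
qed

lemma range_to_complex:
  "range (to_complex :: 'k::real_or_complex \<Rightarrow> complex) = \<real>
   \<or> range (to_complex :: 'k \<Rightarrow> complex) = UNIV"
proof (cases "range (to_complex :: 'k \<Rightarrow> complex) \<subseteq> \<real>")
  case True
  moreover have "(\<real> :: complex set) \<subseteq> range (to_complex :: 'k \<Rightarrow> complex)"
  proof
    fix z :: complex
    assume "z \<in> \<real>"
    then obtain r where "z = of_real r" by (auto elim: Reals_cases)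
    then have "z = to_complex (of_real r :: 'k)" by (simp add: to_complex_of_real)
    then show "z \<in> range (to_complex :: 'k \<Rightarrow> complex)" by blast
  qed
  ultimately show ?thesis by blast
next
  case False
  then obtain w :: 'k where "to_complex w \<notin> \<real>" by blast
  then have w: "Im (to_complex w) \<noteq> 0" by (simp add: complex_is_Real_iff)
  have "z \<in> range (to_complex :: 'k \<Rightarrow> complex)" for z
  proof -
    let ?t = "Im z / Im (to_complex w)"
    let ?y = "of_real (Re z - ?t * Re (to_complex w)) + ?t *\<^sub>R w :: 'k"
    have "to_complex ?y = z"
      unfolding to_complex_add to_complex_scaleR to_complex_of_real
      using w by (simp add: complex_eq_iff)
    then show ?thesis by (metis rangeI)
  qed
  then show ?thesis by blast
qed


text \<open>In \<open>'k^'c^'r\<close>, \<open>'r\<close> indexes the rows and \<open>'c\<close> the columns.\<close>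

definition ctranspose :: "'k::real_or_complex^'c^'r \<Rightarrow> 'k^'r^'c" where
  "ctranspose M = (\<chi> i j. conjg (M $ j $ i))"

definition hermitian :: "'k::real_or_complex^'n^'n \<Rightarrow> bool" where
  "hermitian M \<longleftrightarrow> ctranspose M = M"

definition complex_mat :: "'k::real_or_complex^'c^'r \<Rightarrow> complex^'c^'r" where
  "complex_mat M = (\<chi> i j. to_complex (M $ i $ j))"

definition stack_vec :: "'k^'n \<Rightarrow> 'k^'m \<Rightarrow> 'k^('n + 'm)" where
  "stack_vec x u = (\<chi> i. case i of Inl a \<Rightarrow> x $ a | Inr b \<Rightarrow> u $ b)"

definition stack_mat :: "'k^'c^'n \<Rightarrow> 'k^'c^'m \<Rightarrow> 'k^'c^('n + 'm)" where
  "stack_mat X Y = (\<chi> i. case i of Inl a \<Rightarrow> X $ a | Inr b \<Rightarrow> Y $ b)"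

definition block_mat ::
  "'k^'n^'n \<Rightarrow> 'k^'m^'n \<Rightarrow> 'k^'n^'m \<Rightarrow> 'k^'m^'m \<Rightarrow> 'k^('n + 'm)^('n + 'm)" where
  "block_mat X11 X12 X21 X22 =
     stack_mat (\<chi> i. stack_vec (X11 $ i) (X12 $ i)) (\<chi> i. stack_vec (X21 $ i) (X22 $ i))"

text \<open>
  Positive semidefiniteness of a square matrix \<open>X\<close> whose rows and columns are indexed by a finite set
  \<open>I\<close>. An index set rather than an index type is used because the size of \<open>V\<^sup>* M V\<close> in \<open>psd_on\<close>
  is the dimension of a subspace. For Hermitian \<open>X\<close> the quadratic form is real-valued.
\<close>

definition pos_semidef :: "'i set \<Rightarrow> ('i \<Rightarrow> 'i \<Rightarrow> 'k::real_or_complex) \<Rightarrow> bool" where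
  "pos_semidef I X \<longleftrightarrow>
     (\<forall>i\<in>I. \<forall>j\<in>I. X j i = conjg (X i j)) \<and>
     (\<forall>c :: 'i \<Rightarrow> 'k. 0 \<le> Re (to_complex (\<Sum>i\<in>I. \<Sum>j\<in>I. conjg (c i) * X i j * c j)))"

definition psd :: "'k::real_or_complex^'n^'n \<Rightarrow> bool" where
  "psd M \<longleftrightarrow> pos_semidef UNIV (\<lambda>i j. M $ i $ j)"

definition basis_columns :: "('k::field^'n) list \<Rightarrow> ('k^'n) set \<Rightarrow> bool" where
  "basis_columns vs V \<longleftrightarrow> distinct vs \<and> vec.independent (set vs) \<and> vec.span (set vs) = V"

text \<open>
  The list \<open>vs\<close> consists of the columns of the matrix \<open>V\<close>; the entry \<open>(i, j)\<close> of \<open>V\<^sup>* M V\<close> is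
  \<open>(vs ! i)\<^sup>* M (vs ! j)\<close>.
\<close>

definition psd_on :: "('k::real_or_complex^'n) set \<Rightarrow> 'k^'n^'n \<Rightarrow> bool" where
  "psd_on \<V> M \<longleftrightarrow>
     (\<forall>vs. basis_columns vs \<V> \<longrightarrow>
        pos_semidef {..<length vs}
          (\<lambda>i j. \<Sum>a\<in>UNIV. conjg ((vs ! i) $ a) * (M *v (vs ! j)) $ a))"


definition regular_pencil :: "'k::real_or_complex^'n^'n \<Rightarrow> 'k^'n^'n \<Rightarrow> bool" where
  "regular_pencil E A \<longleftrightarrow> det (\<chi> i j. [:- (A $ i $ j), E $ i $ j:]) \<noteq> 0"

definition systems :: "(('k::real_or_complex^'n^'n) \<times> ('k^'n^'n) \<times> ('k^'m^'n)) set" where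
  "systems = {(E, A, B). regular_pencil E A}"

definition weighted_systems ::
  "(('k::real_or_complex^'n^'n) \<times> ('k^'n^'n) \<times> ('k^'m^'n)
     \<times> ('k^'n^'n) \<times> ('k^'m^'n) \<times> ('k^'m^'m)) set" where
  "weighted_systems = {(E, A, B, Q, S, R). (E, A, B) \<in> systems \<and> hermitian Q \<and> hermitian R}"

definition behavior ::
  "'k::real_or_complex^'n^'n \<Rightarrow> 'k^'n^'n \<Rightarrow> 'k^'m^'n \<Rightarrow> ((nat \<Rightarrow> 'k^'n) \<times> (nat \<Rightarrow> 'k^'m)) set" where
  "behavior E A B = {(x, u). \<forall>j. E *v x (Suc j) = A *v x j + B *v u j}"

definition system_space ::
  "'k::real_or_complex^'n^'n \<Rightarrow> 'k^'n^'n \<Rightarrow> 'k^'m^'n \<Rightarrow> ('k^('n + 'm)) set" where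
  "system_space E A B = vec.span {stack_vec (x j) (u j) | x u j. (x, u) \<in> behavior E A B}"

definition consistent_states ::
  "'k::real_or_complex^'n^'n \<Rightarrow> 'k^'n^'n \<Rightarrow> 'k^'m^'n \<Rightarrow> ('k^'n) set" where
  "consistent_states E A B = {x0. \<exists>(x, u) \<in> behavior E A B. E *v x 0 = E *v x0}"

definition R_controllable ::
  "'k::real_or_complex^'n^'n \<Rightarrow> 'k^'n^'n \<Rightarrow> 'k^'m^'n \<Rightarrow> bool" where
  "R_controllable E A B \<longleftrightarrow>
     (\<forall>x0 \<in> consistent_states E A B. \<forall>xf \<in> consistent_states E A B.
        \<exists>(x, u) \<in> behavior E A B. \<exists>jf. E *v x 0 = E *v x0 \<and> E *v x jf = E *v xf)"

definition kyp_matrix ::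
  "'k::real_or_complex^'n^'n \<Rightarrow> 'k^'n^'n \<Rightarrow> 'k^'m^'n \<Rightarrow> 'k^'n^'n \<Rightarrow> 'k^'m^'n \<Rightarrow> 'k^'m^'m
     \<Rightarrow> 'k^'n^'n \<Rightarrow> 'k^('n + 'm)^('n + 'm)" where
  "kyp_matrix E A B Q S R P =
     block_mat
       (ctranspose A ** P ** A - ctranspose E ** P ** E + Q)  (ctranspose A ** P ** B + S)
       (ctranspose B ** P ** A + ctranspose S)                (ctranspose B ** P ** B + R)"

definition kyp_solution ::
  "'k::real_or_complex^'n^'n \<Rightarrow> 'k^'n^'n \<Rightarrow> 'k^'m^'n \<Rightarrow> 'k^'n^'n \<Rightarrow> 'k^'m^'n \<Rightarrow> 'k^'m^'m
     \<Rightarrow> 'k^'n^'n \<Rightarrow> bool" where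
  "kyp_solution E A B Q S R P \<longleftrightarrow>
     psd_on (system_space E A B) (kyp_matrix E A B Q S R P) \<and> hermitian P"

definition pencil_at :: "'k::real_or_complex^'n^'n \<Rightarrow> 'k^'n^'n \<Rightarrow> complex \<Rightarrow> complex^'n^'n" where
  "pencil_at E A z = (\<chi> i j. z * to_complex (E $ i $ j) - to_complex (A $ i $ j))"

text \<open>
  Rational matrices are represented by their pointwise evaluation. The value of \<open>popov\<close> at \<open>z\<close> is
  meaningful only if \<open>z \<noteq> 0\<close> and the pencil is invertible at both \<open>z\<close> and \<open>1 / cnj z\<close>;
  these two points coincide on the unit circle.
\<close>

definition para_adjoint :: "(complex \<Rightarrow> complex^'c^'r) \<Rightarrow> complex \<Rightarrow> complex^'r^'c" where
  "para_adjoint G z = ctranspose (G (inverse (cnj z)))"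

definition state_input_transfer ::
  "'k::real_or_complex^'n^'n \<Rightarrow> 'k^'n^'n \<Rightarrow> 'k^'m^'n \<Rightarrow> complex \<Rightarrow> complex^'m^('n + 'm)" where
  "state_input_transfer E A B z =
     stack_mat (matrix_inv (pencil_at E A z) ** complex_mat B) (mat 1)"

definition popov ::
  "'k::real_or_complex^'n^'n \<Rightarrow> 'k^'n^'n \<Rightarrow> 'k^'m^'n \<Rightarrow> 'k^'n^'n \<Rightarrow> 'k^'m^'n \<Rightarrow> 'k^'m^'m
     \<Rightarrow> complex \<Rightarrow> complex^'m^'m" where
  "popov E A B Q S R z =
     para_adjoint (state_input_transfer E A B) z
       ** complex_mat (block_mat Q S (ctranspose S) R)
       ** state_input_transfer E A B z"

end

theory Submission
  imports Defs
begin

text \<open>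
  The quadratic form of the KYP matrix at \<open>(x, u)\<close> is the supply, that is the form of the weight,
  plus the increment of the storage form of \<open>P\<close> from \<open>E x\<close> to \<open>A x + B u\<close>. So the
  KYP inequality says that \<open>-P\<close> gives a quadratic storage function: along every step of a trajectory
  it increases by at most the supply.

  If \<open>P\<close> is such a solution and \<open>|z| = 1\<close>, then an input direction \<open>u\<close> generates the complex
  trajectory \<open>z\<^sup>j (x, u)\<close> with \<open>x = (z E - A)\<^sup>-\<^sup>1 B u\<close>. The storage form is the same at \<open>E x\<close> and at
  \<open>A x + B u = z E x\<close>, so only the supply remains, and it equals \<open>u\<^sup>* \<Phi>(z) u\<close>. Over the reals the
  trajectory is split into its real and imaginary part
  (\<open>complex_behavior_nonneg\<close>, \<open>kyp_solution_imp_popov_psd\<close>).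

  For the converse, the required supply of Willems is such a storage function. Let \<open>storage \<xi>\<close> be the
  infimum of the total supply over all trajectories of any length from rest to \<open>\<xi>\<close>. Prolonging
  trajectories by one step gives the dissipation inequality. It remains to see that the infimum is
  finite and quadratic.

  Finiteness: by controllability a trajectory to \<open>\<xi>\<close> can be prolonged to a loop, and loops through
  rest have nonnegative supply (\<open>popov_psd_imp_loop_nonneg\<close>). Indeed, for a loop of length \<open>k\<close> the
  values of its Fourier transform at points \<open>z\<close> of the circle have the form
  \<open>((z E - A)\<^sup>-\<^sup>1 B u, u)\<close>, where the supply is \<open>u\<^sup>* \<Phi>(z) u \<ge> 0\<close>, and by Parseval's
  identity the supply of the loop is the mean of these values over \<open>k\<close> equidistant points. The
  points can be rotated away from the finitely many eigenvalues of the pencil, so no limiting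
  argument at eigenvalues on the circle is needed.

  Quadraticity: sums and differences of trajectories show that the storage function satisfies the
  parallelogram law, and it scales like a norm square. By the theorem of Jordan and von Neumann it is
  given by a Hermitian matrix (\<open>parallelogram_imp_hermitian_matrix\<close>).

  All quadratic forms are expressed by the real inner product, \<open>Re (v\<^sup>* M v) = v \<bullet> (M *v v)\<close>, which
  treats both scalar fields alike.
\<close>


section \<open>The real inner product on vectors over the scalar field\<close>

lemma to_complex_eq_iff [simp]: "to_complex x = to_complex y \<longleftrightarrow> x = y"
  using inj_to_complex by (auto dest: injD)

lemma to_complex_eqI: "to_complex x = to_complex y \<Longrightarrow> x = y"
  by simp

lemma to_complex_zero [simp]: "to_complex 0 = 0"
  using to_complex_of_real[of 0] by simp

lemma to_complex_minus: "to_complex (- x) = - to_complex x"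
  using to_complex_add[of x "- x"] by (simp add: eq_neg_iff_add_eq_0 add.commute)

lemma to_complex_diff: "to_complex (x - y) = to_complex x - to_complex y"
  using to_complex_add[of x "- y"] by (simp add: to_complex_minus)

lemma to_complex_sum: "to_complex (sum f I) = (\<Sum>i\<in>I. to_complex (f i))"
  by (induction I rule: infinite_finite_induct) (simp_all add: to_complex_add)

lemma conjg_add: "conjg (x + y) = conjg x + conjg y"
  and conjg_mult: "conjg (x * y) = conjg x * conjg y"
  and conjg_conjg [simp]: "conjg (conjg x) = x"
  and conjg_zero [simp]: "conjg 0 = 0"
  for x y :: "'k::real_or_complex"
  by (rule to_complex_eqI, simp add: to_complex_conjg to_complex_add to_complex_mult)+

lemma conjg_sum: "conjg (sum f I) = (\<Sum>i\<in>I. conjg (f i))"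
  by (induction I rule: infinite_finite_induct) (simp_all add: conjg_add)

lemma conjg_mult_self: "conjg c * c = of_real ((norm c)\<^sup>2)" for c :: "'k::real_or_complex"
  by (rule to_complex_eqI)
     (simp add: to_complex_conjg to_complex_mult to_complex_of_real mult.commute[of "cnj _"]
        complex_norm_square[symmetric] norm_to_complex
        del: of_real_power)

text \<open>The class fixes the inner product of the scalar field only through its norm, so it is
  recovered by polarization.\<close>

lemma inner_to_complex: "to_complex x \<bullet> to_complex y = x \<bullet> y"
  by (simp add: dot_norm norm_to_complex flip: to_complex_add)

lemma inner_eq_Re: "x \<bullet> y = Re (to_complex (conjg x * y))" for x y :: "'k::real_or_complex"
  unfolding inner_to_complex[symmetric, of x]
  by (simp add: inner_complex_def to_complex_mult to_complex_conjg)

definition sesq :: "'k::real_or_complex^'n \<Rightarrow> 'k^'n \<Rightarrow> 'k" where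
  "sesq x y = (\<Sum>a\<in>UNIV. conjg (x $ a) * y $ a)"

lemma inner_eq_Re_sesq: "x \<bullet> y = Re (to_complex (sesq x y))" for x y :: "'k::real_or_complex^'n"
  by (simp add: inner_vec_def inner_eq_Re sesq_def to_complex_sum)

lemma sesq_scale_left: "sesq (c *s x) y = conjg c * sesq x y"
  by (simp add: sesq_def conjg_mult sum_distrib_left mult_ac)

lemma sesq_scale_right: "sesq x (c *s y) = c * sesq x y"
  by (simp add: sesq_def sum_distrib_left mult_ac)

lemma sesq_sum_left: "sesq (\<Sum>i\<in>I. f i) y = (\<Sum>i\<in>I. sesq (f i) y)"
  unfolding sesq_def by (simp add: conjg_sum sum_distrib_right sum.swap[of _ I])

lemma sesq_sum_right: "sesq x (\<Sum>i\<in>I. f i) = (\<Sum>i\<in>I. sesq x (f i))"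
  unfolding sesq_def by (simp add: sum_distrib_left sum.swap[of _ I])

lemma sesq_ctranspose: "sesq (ctranspose M *v x) y = sesq x (M *v y)"
  unfolding sesq_def matrix_vector_mult_def ctranspose_def
  by (simp add: conjg_sum conjg_mult sum_distrib_left sum_distrib_right mult_ac)
     (rule sum.swap)

lemma inner_scale_left: "(c *s x) \<bullet> y = x \<bullet> (conjg c *s y)" for x y :: "'k::real_or_complex^'n"
  by (simp add: inner_eq_Re_sesq sesq_scale_left sesq_scale_right)

lemma scale_of_real: "of_real r *s x = r *\<^sub>R x" for x :: "'k::real_or_complex^'n"
  by (simp add: vec_eq_iff of_real_def)

lemma inner_scale_scale: "(c *s x) \<bullet> (c *s y) = (norm c)\<^sup>2 * (x \<bullet> y)"
  for x y :: "'k::real_or_complex^'n"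
  by (simp add: inner_scale_left vec.scale_scale conjg_mult_self scale_of_real del: of_real_power)

lemma inner_ctranspose: "(ctranspose M *v x) \<bullet> y = x \<bullet> (M *v y)"
  for x :: "'k::real_or_complex^'n"
  by (simp add: inner_eq_Re_sesq sesq_ctranspose)

lemma matrix_mult_sum: "M *v (\<Sum>i\<in>I. f i) = (\<Sum>i\<in>I. M *v f i)"
  for M :: "'k::real_or_complex^'n^'m"
  by (induction I rule: infinite_finite_induct) (simp_all add: matrix_vector_right_distrib)

lemma matrix_mult_scale: "M *v (c *s x) = c *s (M *v x)" for M :: "'k::real_or_complex^'n^'m"
  by (simp add: vec.scale)

lemma matrix_mult_scaleR: "M *v (r *\<^sub>R x) = r *\<^sub>R (M *v x)" for M :: "'k::real_or_complex^'n^'m"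
  by (simp flip: scale_of_real add: matrix_mult_scale)

lemma hermitian_iff_inner:
  fixes M :: "'k::real_or_complex^'n^'n"
  shows "hermitian M \<longleftrightarrow> (\<forall>x y. x \<bullet> (M *v y) = y \<bullet> (M *v x))"
proof
  assume "hermitian M"
  then have "x \<bullet> (M *v y) = (M *v x) \<bullet> y" for x y
    using inner_ctranspose[of M x y] by (simp add: hermitian_def)
  then show "\<forall>x y. x \<bullet> (M *v y) = y \<bullet> (M *v x)"
    by (simp add: inner_commute)
next
  assume *: "\<forall>x y. x \<bullet> (M *v y) = y \<bullet> (M *v x)"
  have "(ctranspose M *v x) \<bullet> y = (M *v x) \<bullet> y" for x y
    using *[rule_format, of x y] inner_commute[of y] by (simp add: inner_ctranspose)
  then have "ctranspose M *v x = M *v x" for x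
    using vector_eq_rdot by blast
  then show "hermitian M"
    unfolding hermitian_def by (simp add: matrix_eq)
qed


section \<open>Positive semidefiniteness as positivity of a real quadratic form\<close>

lemma psd_iff_inner:
  fixes M :: "'k::real_or_complex^'n^'n"
  shows "psd M \<longleftrightarrow> hermitian M \<and> (\<forall>v. 0 \<le> v \<bullet> (M *v v))"
proof -
  have form: "(\<Sum>i\<in>UNIV. \<Sum>j\<in>UNIV. conjg (c i) * M $ i $ j * c j) = sesq (\<chi> i. c i) (M *v (\<chi> i. c i))"
    for c by (simp add: sesq_def matrix_vector_mult_def sum_distrib_left mult.assoc)
  have "hermitian M \<longleftrightarrow> (\<forall>i j. M $ j $ i = conjg (M $ i $ j))"
    unfolding hermitian_def ctranspose_def vec_eq_iff by (auto simp: eq_commute)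
  moreover have "(\<forall>c. 0 \<le> Re (to_complex (\<Sum>i\<in>UNIV. \<Sum>j\<in>UNIV. conjg (c i) * M $ i $ j * c j)))
      \<longleftrightarrow> (\<forall>v. 0 \<le> v \<bullet> (M *v v))"
    unfolding form inner_eq_Re_sesq by (metis vec_lambda_eta)
  ultimately show ?thesis
    by (simp add: psd_def pos_semidef_def)
qed

text \<open>The matrix in the definition represents the form in the coordinates of a basis, and every
  vector of the subspace is a combination of that basis.\<close>

lemma psd_on_iff_inner:
  fixes M :: "'k::real_or_complex^'n^'n"
  assumes M: "hermitian M" and V: "vec.subspace V"
  shows "psd_on V M \<longleftrightarrow> (\<forall>v\<in>V. 0 \<le> v \<bullet> (M *v v))"
proof -
  have form: "(\<Sum>i\<in>I. \<Sum>j\<in>I. conjg (c i) * sesq (f i) (M *v f j) * c j)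
      = sesq (\<Sum>i\<in>I. c i *s f i) (M *v (\<Sum>i\<in>I. c i *s f i))" for c and f :: "nat \<Rightarrow> 'k^'n" and I
    by (simp add: sesq_sum_left sesq_sum_right matrix_mult_sum matrix_mult_scale
        sesq_scale_left sesq_scale_right sum_distrib_left mult_ac)
       (rule sum.swap)
  have herm: "sesq y (M *v x) = conjg (sesq x (M *v y))" for x y
  proof -
    have "sesq y (M *v x) = sesq (M *v y) x"
      using M by (metis hermitian_def sesq_ctranspose)
    also have "\<dots> = conjg (sesq x (M *v y))"
      by (simp add: sesq_def conjg_sum conjg_mult mult.commute)
    finally show ?thesis .
  qed
  have psd_on: "psd_on V M \<longleftrightarrow> (\<forall>vs. basis_columns vs V \<longrightarrow>
      (\<forall>c. 0 \<le> (\<Sum>i<length vs. c i *s vs ! i) \<bullet> (M *v (\<Sum>i<length vs. c i *s vs ! i))))"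
    unfolding psd_on_def pos_semidef_def sesq_def[symmetric] form inner_eq_Re_sesq[symmetric]
    using herm by blast
  show ?thesis
  proof
    assume psd: "psd_on V M"
    obtain Bs where Bs: "vec.independent Bs" "vec.span Bs = V" and "finite Bs"
      using V vec.basis_exists[of V] vec.span_eq_iff vec.finiteI_independent
      by (metis vec.span_minimal vec.span_mono subset_antisym)
    then obtain vs where vs: "distinct vs" "set vs = Bs"
      using finite_distinct_list by blast
    have basis: "basis_columns vs V"
      using vs Bs by (simp add: basis_columns_def)
    show "\<forall>v\<in>V. 0 \<le> v \<bullet> (M *v v)"
    proof
      fix v assume "v \<in> V"
      then obtain r where "v = (\<Sum>b\<in>Bs. r b *s b)"
        using Bs \<open>finite Bs\<close> vec.span_finite[of Bs] by auto
      also have "\<dots> = (\<Sum>i<length vs. r (vs ! i) *s vs ! i)"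
        using bij_betw_nth[OF vs(1) refl vs(2)[symmetric]]
        by (intro sum.reindex_bij_betw[symmetric])
      finally show "0 \<le> v \<bullet> (M *v v)"
        using psd[unfolded psd_on, rule_format, OF basis, of "\<lambda>i. r (vs ! i)"] by simp
    qed
  next
    assume pos: "\<forall>v\<in>V. 0 \<le> v \<bullet> (M *v v)"
    have "(\<Sum>i<length vs. c i *s vs ! i) \<in> V" if "basis_columns vs V" for vs c
      using that unfolding basis_columns_def
      by (intro vec.subspace_sum[OF V] vec.subspace_scale[OF V])
         (metis nth_mem vec.span_base lessThan_iff)
    then show "psd_on V M"
      unfolding psd_on using pos by blast
  qed
qed


section \<open>Block vectors, weights and the KYP matrix\<close>

lemma stack_vec_nth [simp]:
  "stack_vec x u $ Inl a = x $ a" "stack_vec x u $ Inr b = u $ b"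
  by (simp_all add: stack_vec_def)

lemma sum_Plus_UNIV: "(\<Sum>i\<in>UNIV. f i) = (\<Sum>a\<in>UNIV. f (Inl a)) + (\<Sum>b\<in>UNIV. f (Inr b))"
  for f :: "'n::finite + 'm::finite \<Rightarrow> 'a::comm_monoid_add"
  using sum.Plus[of UNIV UNIV f] by (simp add: UNIV_Plus_UNIV)

lemma vec_eq_Plus_iff:
  "v = w \<longleftrightarrow> (\<forall>a. v $ Inl a = w $ Inl a) \<and> (\<forall>b. v $ Inr b = w $ Inr b)"
  for v w :: "'k^('n::finite + 'm::finite)"
  unfolding vec_eq_iff by (rule split_sum_all)

lemma stack_vec_add: "stack_vec (x + y) (u + w) = stack_vec x u + stack_vec y w"
  and stack_vec_scale: "stack_vec (c *s x) (c *s u) = c *s stack_vec x u"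
  and stack_vec_zero: "stack_vec 0 0 = 0"
  for x y :: "'k::real_or_complex^'n" and u w :: "'k^'m"
  by (simp_all add: vec_eq_Plus_iff)

lemma stack_vec_sum: "stack_vec (\<Sum>i\<in>I. f i) (\<Sum>i\<in>I. g i) = (\<Sum>i\<in>I. stack_vec (f i) (g i))"
  for f :: "'i \<Rightarrow> 'k::real_or_complex^'n" and g :: "'i \<Rightarrow> 'k^'m"
  by (induction I rule: infinite_finite_induct) (simp_all add: stack_vec_zero stack_vec_add)

lemma inner_stack_vec: "stack_vec x u \<bullet> stack_vec y w = x \<bullet> y + u \<bullet> w"
  for x :: "'k::real_or_complex^'n"
  by (simp add: inner_vec_def sum_Plus_UNIV)

lemma stack_mat_mult: "stack_mat X Y *v u = stack_vec (X *v u) (Y *v u)"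
  by (simp add: vec_eq_Plus_iff stack_mat_def matrix_vector_mult_def)

lemma block_mat_mult:
  "block_mat X11 X12 X21 X22 *v stack_vec x u = stack_vec (X11 *v x + X12 *v u) (X21 *v x + X22 *v u)"
  for x :: "'k::real_or_complex^'n"
  by (simp add: vec_eq_Plus_iff block_mat_def stack_mat_def matrix_vector_mult_def sum_Plus_UNIV)

lemma vec_as_stack: obtains x u where "v = stack_vec x u"
proof
  show "v = stack_vec (\<chi> a. v $ Inl a) (\<chi> b. v $ Inr b)"
    by (simp add: vec_eq_Plus_iff)
qed

lemma hermitian_weight:
  fixes Q :: "'k::real_or_complex^'n^'n" and S :: "'k^'m^'n"
  assumes "hermitian Q" "hermitian R"
  shows "hermitian (block_mat Q S (ctranspose S) R)"
proof -
  have S: "u \<bullet> (ctranspose S *v x) = x \<bullet> (S *v u)" for x u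
    by (simp only: inner_commute[of u "ctranspose S *v x"] inner_ctranspose)
  have Q: "x \<bullet> (Q *v y) = y \<bullet> (Q *v x)" and R: "u \<bullet> (R *v w) = w \<bullet> (R *v u)" for x y u w
    using assms unfolding hermitian_iff_inner by blast+
  show ?thesis
    unfolding hermitian_iff_inner
  proof (intro allI)
    fix v v' :: "'k^('n + 'm)"
    obtain x u y w where v: "v = stack_vec x u" "v' = stack_vec y w"
      by (rule vec_as_stack[of v], rule vec_as_stack[of v'])
    show "v \<bullet> (block_mat Q S (ctranspose S) R *v v') = v' \<bullet> (block_mat Q S (ctranspose S) R *v v)"
      unfolding v block_mat_mult inner_stack_vec inner_add_right S
      using Q[of x y] R[of u w] by linarith
  qed
qed

text \<open>This identity is what makes the KYP inequality a dissipation inequality: along a step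
  \<open>E x' = A x + B u\<close> the first two terms are the increment of the storage form of \<open>P\<close>. The bilinear
  version also yields that the KYP matrix is Hermitian.\<close>

lemma kyp_matrix_inner:
  fixes E A :: "'k::real_or_complex^'n^'n" and B S :: "'k^'m^'n"
  shows "stack_vec x u \<bullet> (kyp_matrix E A B Q S R P *v stack_vec y w) =
    (A *v x + B *v u) \<bullet> (P *v (A *v y + B *v w)) - (E *v x) \<bullet> (P *v (E *v y))
    + stack_vec x u \<bullet> (block_mat Q S (ctranspose S) R *v stack_vec y w)"
proof -
  have adj: "x \<bullet> (ctranspose M *v y) = (M *v x) \<bullet> y" for M :: "'k^'a^'b" and x y
    by (simp only: inner_commute[of x "ctranspose M *v y"] inner_ctranspose inner_commute[of y])
  show ?thesis
    unfolding kyp_matrix_def block_mat_mult inner_stack_vec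
    by (simp add: matrix_vector_mult_add_rdistrib matrix_vector_mult_diff_rdistrib
        matrix_vector_right_distrib inner_add_left inner_add_right inner_diff_right
        matrix_vector_mul_assoc[symmetric] adj)
qed

lemma hermitian_kyp_matrix:
  fixes E A :: "'k::real_or_complex^'n^'n" and B S :: "'k^'m^'n"
  assumes "hermitian P" "hermitian Q" "hermitian R"
  shows "hermitian (kyp_matrix E A B Q S R P)"
  unfolding hermitian_iff_inner
proof (intro allI)
  fix v v' :: "'k^('n + 'm)"
  obtain x u y w where v: "v = stack_vec x u" "v' = stack_vec y w"
    by (rule vec_as_stack[of v], rule vec_as_stack[of v'])
  have P: "p \<bullet> (P *v q) = q \<bullet> (P *v p)" for p q
    using assms(1) unfolding hermitian_iff_inner by blast
  have W: "p \<bullet> (block_mat Q S (ctranspose S) R *v q) = q \<bullet> (block_mat Q S (ctranspose S) R *v p)" for p q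
    using hermitian_weight[OF assms(2,3)] unfolding hermitian_iff_inner by blast
  show "v \<bullet> (kyp_matrix E A B Q S R P *v v') = v' \<bullet> (kyp_matrix E A B Q S R P *v v)"
    unfolding v kyp_matrix_inner
    using P[of "A *v x + B *v u" "A *v y + B *v w"] P[of "E *v x" "E *v y"]
      W[of "stack_vec x u" "stack_vec y w"] by linarith
qed


section \<open>Functions satisfying the parallelogram law\<close>

lemma additive_bounded_imp_linear:
  fixes g :: "real \<Rightarrow> real"
  assumes add: "\<And>s t. g (s + t) = g s + g t" and bdd: "\<And>t. \<bar>t\<bar> \<le> 1 \<Longrightarrow> \<bar>g t\<bar> \<le> M"
  shows "g t = t * g 1"
proof -
  define h where "h t = g t - t * g 1" for t
  have h_add: "h (s + t) = h s + h t" for s t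
    by (simp add: h_def add algebra_simps)
  have h_mult: "h (of_nat n * t) = of_nat n * h t" for n t
  proof (induction n)
    case 0
    show ?case using h_add[of 0 0] by simp
  next
    case (Suc n)
    then show ?case by (simp add: distrib_right h_add)
  qed
  have h_int: "h (of_int k) = 0" for k
  proof -
    have nat: "h (of_nat n) = 0" for n
      using h_mult[of n 1] by (simp add: h_def)
    have "h (of_int k) + h (of_int (- k)) = 0"
      using h_add[of "of_int k" "of_int (- k)"] nat[of 0] by simp
    then show ?thesis
      using nat[of "nat k"] nat[of "nat (- k)"] by (cases "0 \<le> k") auto
  qed
  \<comment> \<open>\<open>h\<close> has period 1, so its bound near 0 holds everywhere; an additive function with a global
    bound vanishes.\<close>
  have h_bdd: "\<bar>h t\<bar> \<le> M + \<bar>g 1\<bar>" for t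
  proof -
    have "h t = h (frac t)"
      using h_add[of "frac t" "of_int \<lfloor>t\<rfloor>"] by (simp add: h_int frac_def)
    moreover have "\<bar>frac t\<bar> \<le> 1"
      using frac_lt_1[of t] frac_ge_0[of t] by linarith
    moreover from this have "\<bar>frac t * g 1\<bar> \<le> \<bar>g 1\<bar>"
      by (simp add: abs_mult mult_left_le_one_le)
    ultimately show ?thesis
      using bdd[of "frac t"] unfolding h_def by linarith
  qed
  have "h t = 0"
  proof (rule ccontr)
    assume "h t \<noteq> 0"
    then obtain n where "M + \<bar>g 1\<bar> < of_nat n * \<bar>h t\<bar>"
      using reals_Archimedean3[of "\<bar>h t\<bar>"] by auto
    then show False
      using h_bdd[of "of_nat n * t"] by (simp add: h_mult abs_mult)
  qed
  then show ?thesis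
    by (simp add: h_def)
qed

text \<open>This is the theorem of Jordan and von Neumann. The polarization of \<open>f\<close> is biadditive, and local
  upper bounds on lines make it homogeneous. A local upper bound is enough because the parallelogram
  law turns it into a lower bound.\<close>

theorem parallelogram_imp_quadratic_form:
  fixes f :: "'a::euclidean_space \<Rightarrow> real"
  assumes par: "\<And>x y. f (x + y) + f (x - y) = 2 * f x + 2 * f y"
    and hom: "\<And>t x. f (t *\<^sub>R x) = t\<^sup>2 * f x"
    and bdd: "\<And>x y. \<exists>M. \<forall>t. \<bar>t\<bar> \<le> 1 \<longrightarrow> f (t *\<^sub>R x + y) \<le> M"
  obtains T where "\<And>x. f x = x \<bullet> T x" and "\<And>x y. x \<bullet> T y = (f (x + y) - f (x - y)) / 4"
proof -
  define b where "b x y = f (x + y) - f (x - y)" for x y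
  have f0: "f 0 = 0" and f2: "f (2 *\<^sub>R x) = 4 * f x" and fneg: "f (- x) = f x" for x
    using hom[of 0] hom[of 2 x] hom[of "-1" x] by simp_all
  have b_sym: "b x y = b y x" for x y
    using fneg[of "x - y"] by (simp add: b_def add.commute)
  \<comment> \<open>The term \<open>f (x - z)\<close> of the parallelogram law for the pairs \<open>x + y, z + y\<close> and
    \<open>x - y, z - y\<close> cancels.\<close>
  have b_sum: "b x y + b z y = b (x + z) (2 *\<^sub>R y) / 2" for x y z
    using par[of "x + y" "z + y"] par[of "x - y" "z - y"]
    by (simp add: b_def scaleR_2 algebra_simps)
  have b_zero: "b 0 y = 0" for y
    by (simp add: b_def fneg)
  have b_add: "b (x + z) y = b x y + b z y" for x y z
    using b_sum[of x y z] b_sum[of "x + z" y 0] by (simp add: b_zero)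
  have b_scale: "b (t *\<^sub>R x) y = t * b x y" for t x y
  proof -
    obtain M N where MN: "\<And>t. \<bar>t\<bar> \<le> 1 \<Longrightarrow> f (t *\<^sub>R x + y) \<le> M"
        "\<And>t. \<bar>t\<bar> \<le> 1 \<Longrightarrow> f (t *\<^sub>R x + - y) \<le> N"
      using bdd by meson
    define K where "K = \<bar>M\<bar> + \<bar>N\<bar> + 2 * \<bar>f x\<bar> + 2 * \<bar>f y\<bar>"
    have "\<bar>b (t *\<^sub>R x) y\<bar> \<le> K + K" if t: "\<bar>t\<bar> \<le> 1" for t
    proof -
      have "\<bar>t\<^sup>2 * f x\<bar> \<le> \<bar>f x\<bar>"
        using t by (simp add: abs_mult mult_left_le_one_le abs_square_le_1)
      moreover have "f (t *\<^sub>R x + y) + f (t *\<^sub>R x - y) = 2 * (t\<^sup>2 * f x) + 2 * f y"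
        by (simp add: par hom)
      ultimately show ?thesis
        using MN[OF t] unfolding b_def K_def by simp
    qed
    then have "b (t *\<^sub>R x) y = t * b (1 *\<^sub>R x) y"
      by (intro additive_bounded_imp_linear[of "\<lambda>t. b (t *\<^sub>R x) y" "K + K"])
         (simp_all add: scaleR_left_distrib b_add)
    then show ?thesis by simp
  qed
  define T where "T y = (\<Sum>i\<in>Basis. (b i y / 4) *\<^sub>R i)" for y
  have linear: "linear (\<lambda>x. b x y / 4)" for y
    by (intro linearI) (simp_all add: b_add b_scale add_divide_distrib)
  have T: "x \<bullet> T y = b x y / 4" for x y
  proof -
    have "x \<bullet> T y = (\<Sum>i\<in>Basis. (x \<bullet> i) * (b i y / 4))"
      by (simp add: T_def inner_sum_right mult.commute)
    also have "\<dots> = b (\<Sum>i\<in>Basis. (x \<bullet> i) *\<^sub>R i) y / 4"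
      unfolding linear_sum[OF linear, unfolded o_def] by (simp add: b_scale)
    finally show ?thesis by (simp add: euclidean_representation)
  qed
  show ?thesis
  proof
    show "f x = x \<bullet> T x" for x
      using f2[of x] by (simp add: T b_def f0 scaleR_2)
    show "x \<bullet> T y = (f (x + y) - f (x - y)) / 4" for x y
      by (simp add: T b_def)
  qed
qed

text \<open>If moreover \<open>f\<close> scales like a norm square under all scalars, the representing map is linear
  over the scalar field: the adjoint of multiplication by \<open>c\<close> is multiplication by \<open>conjg c\<close>.\<close>

corollary parallelogram_imp_hermitian_matrix:
  fixes f :: "'k::real_or_complex^'n \<Rightarrow> real"
  assumes par: "\<And>x y. f (x + y) + f (x - y) = 2 * f x + 2 * f y"
    and hom: "\<And>c x. f (c *s x) = (norm c)\<^sup>2 * f x"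
    and bdd: "\<And>x y. \<exists>M. \<forall>t. \<bar>t\<bar> \<le> 1 \<longrightarrow> f (t *\<^sub>R x + y) \<le> M"
  obtains P where "hermitian P" and "\<And>x. f x = x \<bullet> (P *v x)"
proof -
  have homR: "f (t *\<^sub>R x) = t\<^sup>2 * f x" for t x
    using hom[of "of_real t"] by (simp add: scale_of_real)
  obtain T where f: "\<And>x. f x = x \<bullet> T x" and T: "\<And>x y. x \<bullet> T y = (f (x + y) - f (x - y)) / 4"
    using parallelogram_imp_quadratic_form[OF par homR bdd] by blast
  have T_sym: "x \<bullet> T y = y \<bullet> T x" for x y
    using homR[of "-1" "x - y"] by (simp add: T add.commute)
  have T_add: "T (x + y) = T x + T y" for x y
  proof -
    have "T (x + y) \<bullet> z = (T x + T y) \<bullet> z" for z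
      using T_sym[of z "x + y"] T_sym[of z x] T_sym[of z y]
      by (simp add: inner_commute[of _ z] inner_add_left inner_add_right)
    then show ?thesis
      using vector_eq_rdot by blast
  qed
  have T_scale: "T (c *s y) = c *s T y" for c y
  proof (cases "c = 0")
    case True
    then show ?thesis using T_add[of 0 0] by simp
  next
    case False
    have "x \<bullet> (conjg c *s T (c *s y)) = x \<bullet> (conjg c *s (c *s T y))" for x
    proof -
      have "x \<bullet> (conjg c *s T (c *s y)) = (c *s x) \<bullet> T (c *s y)"
        by (simp only: inner_scale_left)
      also have "\<dots> = (norm c)\<^sup>2 * (x \<bullet> T y)"
        unfolding T vec.scale_right_distrib[symmetric] vec.scale_right_diff_distrib[symmetric] hom
        by (simp add: right_diff_distrib diff_divide_distrib)
      also have "\<dots> = x \<bullet> (conjg c *s (c *s T y))"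
        by (simp only: inner_scale_scale inner_scale_left[symmetric])
      finally show ?thesis .
    qed
    then have "conjg c *s T (c *s y) = conjg c *s (c *s T y)"
      using vector_eq_ldot by blast
    moreover have "conjg c \<noteq> 0"
      using False by (metis conjg_conjg conjg_zero)
    ultimately show ?thesis
      by (simp only: vec.scale_cancel_left) simp
  qed
  have "Vector_Spaces.linear (*s) (*s) T"
    by (simp add: Vector_Spaces.linear_iff T_add T_scale vec.vector_space_axioms)
  then have P: "matrix T *v x = T x" for x
    by (rule matrix_works)
  show ?thesis
  proof
    show "hermitian (matrix T)"
      unfolding hermitian_iff_inner P using T_sym by blast
    show "f x = x \<bullet> (matrix T *v x)" for x
      by (simp add: P f)
  qed
qed


section \<open>Trajectories\<close>

lemma behavior_iff: "(x, u) \<in> behavior E A B \<longleftrightarrow> (\<forall>j. E *v x (Suc j) = A *v x j + B *v u j)"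
  by (simp add: behavior_def)

lemma behavior_add:
  assumes "(x, u) \<in> behavior E A B" "(y, w) \<in> behavior E A B"
  shows "(\<lambda>j. x j + y j, \<lambda>j. u j + w j) \<in> behavior E A B"
  using assms by (simp add: behavior_iff matrix_vector_right_distrib)

lemma behavior_scale:
  assumes "(x, u) \<in> behavior E A B"
  shows "(\<lambda>j. c *s x j, \<lambda>j. c *s u j) \<in> behavior E A B"
  using assms by (simp add: behavior_iff matrix_mult_scale vec.scale_right_distrib)

lemma behavior_diff:
  assumes "(x, u) \<in> behavior E A B" "(y, w) \<in> behavior E A B"
  shows "(\<lambda>j. x j - y j, \<lambda>j. u j - w j) \<in> behavior E A B"
  using assms by (simp add: behavior_iff matrix_vector_mult_diff_distrib)

lemma behavior_zero: "(\<lambda>_. 0, \<lambda>_. 0) \<in> behavior E A B"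
  by (simp add: behavior_iff)

lemma behavior_shift:
  assumes "(x, u) \<in> behavior E A B"
  shows "(\<lambda>j. x (j + k), \<lambda>j. u (j + k)) \<in> behavior E A B"
  using assms by (simp add: behavior_iff)

definition append_at :: "nat \<Rightarrow> (nat \<Rightarrow> 'a) \<Rightarrow> (nat \<Rightarrow> 'a) \<Rightarrow> nat \<Rightarrow> 'a" where
  "append_at k f g j = (if j < k then f j else g (j - k))"

lemma behavior_append:
  assumes "(x, u) \<in> behavior E A B" "(y, w) \<in> behavior E A B" "E *v x k = E *v y 0"
  shows "(append_at k x y, append_at k u w) \<in> behavior E A B"
  unfolding behavior_iff
proof
  fix j
  consider "Suc j < k" | "Suc j = k" | "k \<le> j" by linarith
  then show "E *v append_at k x y (Suc j) = A *v append_at k x y j + B *v append_at k u w j"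
    using assms by cases (auto simp: append_at_def behavior_iff Suc_diff_le)
qed

text \<open>Trajectories can be added, scaled and shifted, so their values already form a subspace.\<close>

lemma system_space_subset:
  "system_space E A B \<subseteq> {stack_vec (x 0) (u 0) |x u. (x, u) \<in> behavior E A B}"
  (is "_ \<subseteq> ?V")
proof -
  have V: "stack_vec (x 0) (u 0) \<in> ?V" if "(x, u) \<in> behavior E A B" for x u
    using that by blast
  have "vec.subspace ?V"
  proof (rule vec.subspaceI)
    show "0 \<in> ?V"
      using V[OF behavior_zero] by (simp only: stack_vec_zero)
  next
    fix v w assume "v \<in> ?V" "w \<in> ?V"
    then obtain x u y w' where "(x, u) \<in> behavior E A B" "(y, w') \<in> behavior E A B"
        and v: "v = stack_vec (x 0) (u 0)" "w = stack_vec (y 0) (w' 0)"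
      by blast
    from V[OF behavior_add[OF this(1,2)]] show "v + w \<in> ?V"
      by (simp only: v stack_vec_add)
  next
    fix c v assume "v \<in> ?V"
    then obtain x u where "(x, u) \<in> behavior E A B" and v: "v = stack_vec (x 0) (u 0)"
      by blast
    from V[OF behavior_scale[OF this(1), of c]] show "c *s v \<in> ?V"
      by (simp only: v stack_vec_scale)
  qed
  moreover have "stack_vec (x j) (u j) \<in> ?V" if "(x, u) \<in> behavior E A B" for x u j
    using V[OF behavior_shift[OF that, of j]] by simp
  ultimately show ?thesis
    unfolding system_space_def by (intro vec.span_minimal) auto
qed


section \<open>Total supply\<close>

definition total_supply ::
  "'k::real_or_complex^('n + 'm)^('n + 'm) \<Rightarrow> (nat \<Rightarrow> 'k^'n) \<Rightarrow> (nat \<Rightarrow> 'k^'m) \<Rightarrow> nat \<Rightarrow> real" where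
  "total_supply W x u k = (\<Sum>j<k. stack_vec (x j) (u j) \<bullet> (W *v stack_vec (x j) (u j)))"

lemma total_supply_append:
  "total_supply W (append_at k x y) (append_at k u w) (k + l) = total_supply W x u k + total_supply W y w l"
proof (induction l)
  case 0
  show ?case by (simp add: total_supply_def append_at_def)
next
  case (Suc l)
  then show ?case by (simp add: total_supply_def append_at_def)
qed

lemma quadratic_parallelogram:
  "(v + w) \<bullet> (M *v (v + w)) + (v - w) \<bullet> (M *v (v - w)) = 2 * (v \<bullet> (M *v v)) + 2 * (w \<bullet> (M *v w))"
  for M :: "'k::real_or_complex^'n^'n"
  by (simp add: matrix_vector_right_distrib matrix_vector_mult_diff_distrib inner_add_left
      inner_add_right inner_diff_left inner_diff_right)

lemma total_supply_parallelogram: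
  "total_supply W (\<lambda>j. x j + y j) (\<lambda>j. u j + w j) k + total_supply W (\<lambda>j. x j - y j) (\<lambda>j. u j - w j) k
    = 2 * total_supply W x u k + 2 * total_supply W y w k"
proof -
  have diff: "stack_vec (x j - y j) (u j - w j) = stack_vec (x j) (u j) - stack_vec (y j) (w j)" for j
    unfolding eq_diff_eq stack_vec_add[symmetric] by simp
  show ?thesis
    unfolding total_supply_def stack_vec_add diff sum_distrib_left sum.distrib[symmetric]
      quadratic_parallelogram ..
qed

lemma total_supply_scale: "total_supply W (\<lambda>j. c *s x j) (\<lambda>j. c *s u j) k = (norm c)\<^sup>2 * total_supply W x u k"
  unfolding total_supply_def stack_vec_scale matrix_mult_scale inner_scale_scale sum_distrib_left ..

lemma total_supply_zero: "total_supply W (\<lambda>_. 0) (\<lambda>_. 0) k = 0"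
  by (simp add: total_supply_def stack_vec_zero)

lemma total_supply_affine_bounded:
  "\<exists>M. \<forall>t::real. \<bar>t\<bar> \<le> 1 \<longrightarrow>
    total_supply W (\<lambda>j. of_real t *s x j + y j) (\<lambda>j. of_real t *s u j + w j) k \<le> M"
proof -
  define v v' where "v j = stack_vec (x j) (u j)" and "v' j = stack_vec (y j) (w j)" for j
  have v: "stack_vec (of_real t *s x j + y j) (of_real t *s u j + w j) = t *\<^sub>R v j + v' j" for t j
    unfolding stack_vec_add stack_vec_scale
    unfolding scale_of_real v_def v'_def ..
  have "total_supply W (\<lambda>j. of_real t *s x j + y j) (\<lambda>j. of_real t *s u j + w j) k
      = t\<^sup>2 * (\<Sum>j<k. v j \<bullet> (W *v v j)) + t * (\<Sum>j<k. v j \<bullet> (W *v v' j) + v' j \<bullet> (W *v v j))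
        + (\<Sum>j<k. v' j \<bullet> (W *v v' j))" (is "_ = t\<^sup>2 * ?a + t * ?b + ?c") for t
    unfolding total_supply_def v
    by (simp add: matrix_vector_right_distrib matrix_mult_scaleR inner_add_left inner_add_right
        power2_eq_square sum.distrib sum_distrib_left algebra_simps)
  moreover have "t\<^sup>2 * ?a + t * ?b + ?c \<le> \<bar>?a\<bar> + \<bar>?b\<bar> + \<bar>?c\<bar>" if "\<bar>t\<bar> \<le> 1" for t
  proof -
    have "\<bar>t\<^sup>2 * ?a\<bar> \<le> \<bar>?a\<bar>" "\<bar>t * ?b\<bar> \<le> \<bar>?b\<bar>"
      using that by (simp_all add: abs_mult mult_left_le_one_le abs_square_le_1)
    then show ?thesis by linarith
  qed
  ultimately show ?thesis
    by (intro exI[of _ "\<bar>?a\<bar> + \<bar>?b\<bar> + \<bar>?c\<bar>"]) simp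
qed

section \<open>The required supply of a controllable system\<close>

locale controllable_dissipative =
  fixes E A :: "'k::real_or_complex^'n^'n" and B :: "'k^'m^'n" and W :: "'k^('n + 'm)^('n + 'm)"
  assumes controllable: "R_controllable E A B"
    and loop_nonneg: "\<And>x u k. \<lbrakk>(x, u) \<in> behavior E A B; E *v x 0 = 0; E *v x k = 0\<rbrakk>
      \<Longrightarrow> 0 \<le> total_supply W x u k"
begin

definition attainable :: "('k^'n) set" where
  "attainable = {E *v x 0 |x u. (x, u) \<in> behavior E A B}"

lemma attainableI:
  assumes "(x, u) \<in> behavior E A B"
  shows "E *v x k \<in> attainable"
proof -
  have "E *v x 0 \<in> attainable" if "(x, u) \<in> behavior E A B" for x u
    using that unfolding attainable_def by blast
  from this[OF behavior_shift[OF assms, of k]] show ?thesis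
    by simp
qed

lemma subspace_attainable: "vec.subspace attainable"
proof (rule vec.subspaceI)
  show "0 \<in> attainable"
    using attainableI[OF behavior_zero] by simp
next
  fix \<xi> \<eta> assume "\<xi> \<in> attainable" "\<eta> \<in> attainable"
  then obtain x u y w where "(x, u) \<in> behavior E A B" "(y, w) \<in> behavior E A B"
      and eq: "\<xi> = E *v x 0" "\<eta> = E *v y 0"
    unfolding attainable_def by blast
  from attainableI[OF behavior_add[OF this(1,2)], of 0] show "\<xi> + \<eta> \<in> attainable"
    by (simp add: eq matrix_vector_right_distrib)
next
  fix c \<xi> assume "\<xi> \<in> attainable"
  then obtain x u where "(x, u) \<in> behavior E A B" and eq: "\<xi> = E *v x 0"
    unfolding attainable_def by blast
  from attainableI[OF behavior_scale[OF this(1)], of c 0] show "c *s \<xi> \<in> attainable"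
    by (simp add: eq matrix_mult_scale)
qed

lemma transfer_exists:
  assumes "\<xi> \<in> attainable" "\<eta> \<in> attainable"
  obtains x u k where "(x, u) \<in> behavior E A B" "E *v x 0 = \<xi>" "E *v x k = \<eta>"
proof -
  obtain x0 xf where "x0 \<in> consistent_states E A B" "xf \<in> consistent_states E A B"
      "E *v x0 = \<xi>" "E *v xf = \<eta>"
    using assms unfolding attainable_def consistent_states_def by blast
  then show ?thesis
    using controllable that unfolding R_controllable_def by blast
qed

text \<open>The number of steps is not fixed, so that trajectories can be prolonged. Since the system
  can rest longer at the beginning, any two costs are realized with a common number of steps.\<close>

definition costs :: "'k^'n \<Rightarrow> real set" where
  "costs \<xi> = {total_supply W x u k |x u k. (x, u) \<in> behavior E A B \<and> E *v x 0 = 0 \<and> E *v x k = \<xi>}"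

lemma costsI: "\<lbrakk>(x, u) \<in> behavior E A B; E *v x 0 = 0\<rbrakk> \<Longrightarrow> total_supply W x u k \<in> costs (E *v x k)"
  unfolding costs_def by blast

lemma costs_append:
  assumes "a \<in> costs (E *v y 0)" and y: "(y, w) \<in> behavior E A B"
  shows "a + total_supply W y w l \<in> costs (E *v y l)"
proof -
  obtain x u k where x: "(x, u) \<in> behavior E A B" "E *v x 0 = 0" "E *v x k = E *v y 0"
      and a: "a = total_supply W x u k"
    using assms(1) unfolding costs_def by auto
  have "E *v append_at k x y 0 = 0"
    using x by (cases k) (auto simp: append_at_def)
  from costsI[OF behavior_append[OF x(1) y x(3)] this, of "k + l"]
  show ?thesis
    unfolding total_supply_append a by (simp add: append_at_def)
qed

lemma costs_long:
  assumes "a \<in> costs \<xi>"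
  obtains K where "\<And>k. K \<le> k \<Longrightarrow>
    \<exists>x u. (x, u) \<in> behavior E A B \<and> E *v x 0 = 0 \<and> E *v x k = \<xi> \<and> a = total_supply W x u k"
proof -
  obtain x u K where x: "(x, u) \<in> behavior E A B" "E *v x 0 = 0" "E *v x K = \<xi>"
      and a: "a = total_supply W x u K"
    using assms unfolding costs_def by auto
  show ?thesis
  proof
    fix k assume k: "K \<le> k"
    let ?x = "append_at (k - K) (\<lambda>_. 0) x" and ?u = "append_at (k - K) (\<lambda>_. 0) u"
    have "(?x, ?u) \<in> behavior E A B"
      using x by (intro behavior_append behavior_zero) simp_all
    moreover have "E *v ?x 0 = 0" "E *v ?x k = \<xi>"
      using x k by (auto simp: append_at_def)
    moreover have "a = total_supply W ?x ?u k"
      using total_supply_append[of W "k - K" "\<lambda>_. 0" x "\<lambda>_. 0" u K] k by (simp add: a total_supply_zero)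
    ultimately show "\<exists>x u. (x, u) \<in> behavior E A B \<and> E *v x 0 = 0 \<and> E *v x k = \<xi> \<and> a = total_supply W x u k"
      by blast
  qed
qed

text \<open>Controllability enters twice: every attainable \<open>\<xi>\<close> can be reached from rest, and the system
  can be brought back to rest, which bounds the costs from below because loops consume a
  nonnegative supply.\<close>

lemma costs_nonempty:
  assumes "\<xi> \<in> attainable"
  shows "costs \<xi> \<noteq> {}"
proof -
  obtain x u k where "(x, u) \<in> behavior E A B" "E *v x 0 = 0" "E *v x k = \<xi>"
    by (rule transfer_exists[OF vec.subspace_0[OF subspace_attainable] assms])
  then show ?thesis
    unfolding costs_def by blast
qed

lemma costs_bdd_below:
  assumes "\<xi> \<in> attainable"
  shows "bdd_below (costs \<xi>)"
proof -
  obtain y w l where y: "(y, w) \<in> behavior E A B" "E *v y 0 = \<xi>" "E *v y l = 0"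
    by (rule transfer_exists[OF assms vec.subspace_0[OF subspace_attainable]])
  have "- total_supply W y w l \<le> a" if "a \<in> costs \<xi>" for a
  proof -
    have "a + total_supply W y w l \<in> costs 0"
      using costs_append[of a y w l] that y by simp
    then have "0 \<le> a + total_supply W y w l"
      using loop_nonneg unfolding costs_def by auto
    then show ?thesis by simp
  qed
  then show ?thesis
    by (rule bdd_belowI)
qed

text \<open>The required supply in the sense of Willems.\<close>

definition storage :: "'k^'n \<Rightarrow> real" where
  "storage \<xi> = Inf (costs \<xi>)"

lemma storage_le: "\<lbrakk>\<xi> \<in> attainable; a \<in> costs \<xi>\<rbrakk> \<Longrightarrow> storage \<xi> \<le> a"
  unfolding storage_def by (simp add: cInf_lower costs_bdd_below)

lemma storage_greatest:
  "\<lbrakk>\<xi> \<in> attainable; \<And>a. a \<in> costs \<xi> \<Longrightarrow> c \<le> a\<rbrakk> \<Longrightarrow> c \<le> storage \<xi>"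
  unfolding storage_def by (simp add: cInf_greatest costs_nonempty)

text \<open>The dissipation inequality holds because every trajectory to the state \<open>E *v x 0\<close> can be
  prolonged by the first step of \<open>(x, u)\<close>.\<close>

lemma storage_step:
  assumes x: "(x, u) \<in> behavior E A B"
  shows "storage (A *v x 0 + B *v u 0)
    \<le> storage (E *v x 0) + stack_vec (x 0) (u 0) \<bullet> (W *v stack_vec (x 0) (u 0))"
proof -
  have "storage (E *v x 1) - total_supply W x u 1 \<le> storage (E *v x 0)"
  proof (rule storage_greatest)
    show "storage (E *v x 1) - total_supply W x u 1 \<le> a" if "a \<in> costs (E *v x 0)" for a
      using storage_le[OF attainableI[OF x] costs_append[OF that x], of 1] by simp
  qed (rule attainableI[OF x])
  moreover have "E *v x 1 = A *v x 0 + B *v u 0"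
    using x by (simp add: behavior_iff)
  ultimately show ?thesis
    by (simp add: total_supply_def)
qed

lemma storage_zero: "storage 0 = 0"
proof (rule antisym)
  show "storage 0 \<le> 0"
    using storage_le[OF vec.subspace_0[OF subspace_attainable]]
      costsI[OF behavior_zero, where k = 0] by (simp add: total_supply_def)
  show "0 \<le> storage 0"
    using loop_nonneg
    by (intro storage_greatest vec.subspace_0[OF subspace_attainable]) (auto simp: costs_def)
qed

text \<open>Scaling trajectories gives one inequality; the other one follows by scaling back, except
  for \<open>c = 0\<close>, where the nonnegative supply of loops is needed.\<close>

lemma storage_scale:
  assumes \<xi>: "\<xi> \<in> attainable"
  shows "storage (c *s \<xi>) = (norm c)\<^sup>2 * storage \<xi>"
proof -
  have le: "storage (c *s \<xi>) \<le> (norm c)\<^sup>2 * storage \<xi>" if \<xi>: "\<xi> \<in> attainable" and c: "c \<noteq> 0" for c \<xi>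
  proof -
    have "storage (c *s \<xi>) / (norm c)\<^sup>2 \<le> storage \<xi>"
    proof (rule storage_greatest[OF \<xi>])
      fix a assume "a \<in> costs \<xi>"
      then obtain x u k where x: "(x, u) \<in> behavior E A B" "E *v x 0 = 0" "E *v x k = \<xi>"
          and a: "a = total_supply W x u k"
        unfolding costs_def by auto
      have "(norm c)\<^sup>2 * a \<in> costs (c *s \<xi>)"
        using costsI[OF behavior_scale[OF x(1)], of c k] x by (simp add: matrix_mult_scale total_supply_scale a)
      then have "storage (c *s \<xi>) \<le> (norm c)\<^sup>2 * a"
        using storage_le vec.subspace_scale[OF subspace_attainable \<xi>] by blast
      then show "storage (c *s \<xi>) / (norm c)\<^sup>2 \<le> a"
        using c by (simp add: divide_le_eq mult.commute)
    qed
    then show ?thesis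
      using c by (simp add: divide_le_eq mult.commute)
  qed
  show ?thesis
  proof (cases "c = 0")
    case True
    then show ?thesis by (simp add: storage_zero)
  next
    case False
    have "storage \<xi> \<le> (norm (inverse c))\<^sup>2 * storage (c *s \<xi>)"
      using le[of "c *s \<xi>" "inverse c"] False vec.subspace_scale[OF subspace_attainable \<xi>]
      by (simp add: vec.scale_scale)
    then have "(norm c)\<^sup>2 * storage \<xi> \<le> storage (c *s \<xi>)"
      using False
      by (simp only: norm_inverse power_inverse inverse_eq_divide[of "(norm c)\<^sup>2"])
         (simp add: pos_le_divide_eq mult.commute)
    then show ?thesis
      using le[OF \<xi> False] by simp
  qed
qed

text \<open>Adding and subtracting two trajectories of equal length gives one inequality of the
  parallelogram law; the other one is the same inequality for \<open>\<xi> + \<eta>\<close> and \<open>\<xi> - \<eta>\<close>.\<close>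

lemma storage_parallelogram_le:
  assumes \<xi>: "\<xi> \<in> attainable" and \<eta>: "\<eta> \<in> attainable"
  shows "storage (\<xi> + \<eta>) + storage (\<xi> - \<eta>) \<le> 2 * storage \<xi> + 2 * storage \<eta>"
proof -
  have le: "storage (\<xi> + \<eta>) + storage (\<xi> - \<eta>) \<le> 2 * a + 2 * b" if a: "a \<in> costs \<xi>" and b: "b \<in> costs \<eta>" for a b
  proof -
    obtain K L where K: "\<And>k. K \<le> k \<Longrightarrow>
        \<exists>x u. (x, u) \<in> behavior E A B \<and> E *v x 0 = 0 \<and> E *v x k = \<xi> \<and> a = total_supply W x u k"
      and L: "\<And>k. L \<le> k \<Longrightarrow>
        \<exists>x u. (x, u) \<in> behavior E A B \<and> E *v x 0 = 0 \<and> E *v x k = \<eta> \<and> b = total_supply W x u k"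
      by (rule costs_long[OF a], rule costs_long[OF b]) blast
    obtain x u y w where x: "(x, u) \<in> behavior E A B" "E *v x 0 = 0" "E *v x (max K L) = \<xi>"
        and y: "(y, w) \<in> behavior E A B" "E *v y 0 = 0" "E *v y (max K L) = \<eta>"
        and ab: "a = total_supply W x u (max K L)" "b = total_supply W y w (max K L)"
      using K[of "max K L"] L[of "max K L"] by auto
    have "total_supply W (\<lambda>j. x j + y j) (\<lambda>j. u j + w j) (max K L) \<in> costs (\<xi> + \<eta>)"
      using costsI[OF behavior_add[OF x(1) y(1)], of "max K L"] x y
      by (simp add: matrix_vector_right_distrib)
    moreover have "total_supply W (\<lambda>j. x j - y j) (\<lambda>j. u j - w j) (max K L) \<in> costs (\<xi> - \<eta>)"
      using costsI[OF behavior_diff[OF x(1) y(1)], of "max K L"] x y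
      by (simp add: matrix_vector_mult_diff_distrib)
    ultimately show ?thesis
      unfolding ab total_supply_parallelogram[symmetric]
      using vec.subspace_add[OF subspace_attainable \<xi> \<eta>] vec.subspace_diff[OF subspace_attainable \<xi> \<eta>]
      by (intro add_mono storage_le)
  qed
  have "(storage (\<xi> + \<eta>) + storage (\<xi> - \<eta>) - 2 * storage \<xi>) / 2 \<le> storage \<eta>"
  proof (rule storage_greatest[OF \<eta>])
    fix b assume b: "b \<in> costs \<eta>"
    have "(storage (\<xi> + \<eta>) + storage (\<xi> - \<eta>) - 2 * b) / 2 \<le> storage \<xi>"
      using le[OF _ b] by (intro storage_greatest[OF \<xi>]) (simp add: field_simps)
    then show "(storage (\<xi> + \<eta>) + storage (\<xi> - \<eta>) - 2 * storage \<xi>) / 2 \<le> b"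
      by simp
  qed
  then show ?thesis by simp
qed

lemma storage_parallelogram:
  assumes \<xi>: "\<xi> \<in> attainable" and \<eta>: "\<eta> \<in> attainable"
  shows "storage (\<xi> + \<eta>) + storage (\<xi> - \<eta>) = 2 * storage \<xi> + 2 * storage \<eta>"
proof -
  have double: "storage (2 *s \<zeta>) = 4 * storage \<zeta>" if "\<zeta> \<in> attainable" for \<zeta>
    using storage_scale[OF that, of 2] by simp
  have "(\<xi> + \<eta>) + (\<xi> - \<eta>) = 2 *s \<xi>" "(\<xi> + \<eta>) - (\<xi> - \<eta>) = 2 *s \<eta>"
    by (simp_all add: vec_eq_iff)
  then have "4 * storage \<xi> + 4 * storage \<eta> \<le> 2 * storage (\<xi> + \<eta>) + 2 * storage (\<xi> - \<eta>)"
    using storage_parallelogram_le[of "\<xi> + \<eta>" "\<xi> - \<eta>"]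
      vec.subspace_add[OF subspace_attainable \<xi> \<eta>] vec.subspace_diff[OF subspace_attainable \<xi> \<eta>]
    by (simp only: double[OF \<xi>] double[OF \<eta>])
  then show ?thesis
    using storage_parallelogram_le[OF \<xi> \<eta>] by linarith
qed

lemma storage_locally_bounded:
  assumes "\<xi> \<in> attainable" "\<eta> \<in> attainable"
  shows "\<exists>M. \<forall>t. \<bar>t\<bar> \<le> 1 \<longrightarrow> storage (t *\<^sub>R \<xi> + \<eta>) \<le> M"
proof -
  obtain a b where a: "a \<in> costs \<xi>" and b: "b \<in> costs \<eta>"
    using assms costs_nonempty by blast
  obtain K L where K: "\<And>k. K \<le> k \<Longrightarrow>
      \<exists>x u. (x, u) \<in> behavior E A B \<and> E *v x 0 = 0 \<and> E *v x k = \<xi> \<and> a = total_supply W x u k"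
    and L: "\<And>k. L \<le> k \<Longrightarrow>
      \<exists>x u. (x, u) \<in> behavior E A B \<and> E *v x 0 = 0 \<and> E *v x k = \<eta> \<and> b = total_supply W x u k"
    by (rule costs_long[OF a], rule costs_long[OF b]) blast
  obtain x u y w where x: "(x, u) \<in> behavior E A B" "E *v x 0 = 0" "E *v x (max K L) = \<xi>"
      and y: "(y, w) \<in> behavior E A B" "E *v y 0 = 0" "E *v y (max K L) = \<eta>"
    using K[of "max K L"] L[of "max K L"] by auto
  obtain M where M: "\<And>t::real. \<bar>t\<bar> \<le> 1 \<Longrightarrow>
      total_supply W (\<lambda>j. of_real t *s x j + y j) (\<lambda>j. of_real t *s u j + w j) (max K L) \<le> M"
    using total_supply_affine_bounded[of W x y u w "max K L"] by blast
  have "storage (t *\<^sub>R \<xi> + \<eta>) \<le> M" if t: "\<bar>t\<bar> \<le> 1" for t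
  proof -
    have beh: "(\<lambda>j. of_real t *s x j + y j, \<lambda>j. of_real t *s u j + w j) \<in> behavior E A B"
      by (intro behavior_add[OF behavior_scale[OF x(1)] y(1)])
    have eq: "E *v (of_real t *s x j + y j) = t *\<^sub>R (E *v x j) + E *v y j" for j
      by (simp add: matrix_vector_right_distrib scale_of_real matrix_mult_scaleR)
    have "t *\<^sub>R \<xi> + \<eta> \<in> attainable"
      using attainableI[OF beh, of "max K L"] by (simp add: eq x y)
    moreover have "total_supply W (\<lambda>j. of_real t *s x j + y j) (\<lambda>j. of_real t *s u j + w j) (max K L)
        \<in> costs (t *\<^sub>R \<xi> + \<eta>)"
      using costsI[OF beh, of "max K L"] by (simp add: eq x y)
    ultimately show ?thesis
      using storage_le M[OF t] by (meson order_trans)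
  qed
  then show ?thesis by blast
qed

lemma storage_matrix:
  obtains P where "hermitian P" "\<And>\<xi>. \<xi> \<in> attainable \<Longrightarrow> storage \<xi> = \<xi> \<bullet> (P *v \<xi>)"
proof -
  \<comment> \<open>A linear projection onto the attainable subspace extends the storage function to all vectors.\<close>
  obtain \<pi> where \<pi>: "Vector_Spaces.linear (*s) (*s) \<pi>" "range \<pi> \<subseteq> attainable"
      "\<And>\<xi>. \<xi> \<in> attainable \<Longrightarrow> \<pi> \<xi> = \<xi>"
    using vec.linear_exists_left_inverse_on[OF vec.linear_ident subspace_attainable] by auto
  have \<pi>_mem: "\<pi> x \<in> attainable" for x
    using \<pi>(2) by blast
  have \<pi>_add: "\<pi> (x + y) = \<pi> x + \<pi> y" and \<pi>_diff: "\<pi> (x - y) = \<pi> x - \<pi> y"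
    and \<pi>_scale: "\<pi> (c *s x) = c *s \<pi> x" for x y c
    using \<pi>(1) by (simp_all add: vec.linear_add vec.linear_diff vec.linear_scale)
  obtain P where "hermitian P" "\<And>x. storage (\<pi> x) = x \<bullet> (P *v x)"
  proof (rule parallelogram_imp_hermitian_matrix[of "\<lambda>x. storage (\<pi> x)"])
    show "storage (\<pi> (x + y)) + storage (\<pi> (x - y)) = 2 * storage (\<pi> x) + 2 * storage (\<pi> y)" for x y
      unfolding \<pi>_add \<pi>_diff by (rule storage_parallelogram[OF \<pi>_mem \<pi>_mem])
    show "storage (\<pi> (c *s x)) = (norm c)\<^sup>2 * storage (\<pi> x)" for c x
      unfolding \<pi>_scale by (rule storage_scale[OF \<pi>_mem])
    show "\<exists>M. \<forall>t. \<bar>t\<bar> \<le> 1 \<longrightarrow> storage (\<pi> (t *\<^sub>R x + y)) \<le> M" for x y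
      unfolding scale_of_real[symmetric] \<pi>_add \<pi>_scale
      unfolding scale_of_real by (rule storage_locally_bounded[OF \<pi>_mem \<pi>_mem])
  qed blast
  then show ?thesis
    using that \<pi>(3) by metis
qed

end

theorem controllable_dissipative_imp_kyp_solution:
  fixes E A Q :: "'k::real_or_complex^'n^'n" and B S :: "'k^'m^'n"
  assumes "hermitian Q" "hermitian R"
    and "controllable_dissipative E A B (block_mat Q S (ctranspose S) R)"
  shows "\<exists>P. kyp_solution E A B Q S R P"
proof -
  interpret controllable_dissipative E A B "block_mat Q S (ctranspose S) R"
    by fact
  obtain P where P: "hermitian P" "\<And>\<xi>. \<xi> \<in> attainable \<Longrightarrow> storage \<xi> = \<xi> \<bullet> (P *v \<xi>)"
    using storage_matrix by blast
  \<comment> \<open>The required supply increases by at most the supply of a step, whereas the KYP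
    inequality adds the increment of its storage form to the supply; hence the sign.\<close>
  have minus: "(- P) *v \<xi> = - (P *v \<xi>)" for \<xi>
    by (simp add: vec_eq_iff matrix_vector_mult_def sum_negf)
  have herm: "hermitian (- P)"
    using P(1) unfolding hermitian_iff_inner minus by simp
  have "0 \<le> v \<bullet> (kyp_matrix E A B Q S R (- P) *v v)" if mem: "v \<in> system_space E A B" for v
  proof -
    obtain x u where v: "v = stack_vec (x 0) (u 0)" and x: "(x, u) \<in> behavior E A B"
      using subsetD[OF system_space_subset mem] by auto
    have "A *v x 0 + B *v u 0 = E *v x 1"
      using x by (simp add: behavior_iff)
    then have "A *v x 0 + B *v u 0 \<in> attainable" "E *v x 0 \<in> attainable"
      using attainableI[OF x] by simp_all
    then show ?thesis
      using storage_step[OF x] unfolding v kyp_matrix_inner minus by (simp add: P(2))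
  qed
  then have "psd_on (system_space E A B) (kyp_matrix E A B Q S R (- P))"
    by (subst psd_on_iff_inner)
       (auto intro: hermitian_kyp_matrix herm assms simp: system_space_def)
  then show ?thesis
    using herm unfolding kyp_solution_def by blast
qed


section \<open>Complexification\<close>

lemma conjg_complex [simp]: "conjg z = cnj z"
  by (simp add: conjg_complex_def)

lemma to_complex_complex [simp]: "to_complex z = z" for z :: complex
  by (simp add: to_complex_complex_def)

definition complex_vec :: "'k::real_or_complex^'n \<Rightarrow> complex^'n" where
  "complex_vec x = (\<chi> i. to_complex (x $ i))"

lemma complex_vec_zero [simp]: "complex_vec 0 = 0"
  by (simp add: complex_vec_def vec_eq_iff)

lemma complex_mat_mult_vec: "complex_mat M *v complex_vec x = complex_vec (M *v x)"
  by (simp add: complex_mat_def complex_vec_def vec_eq_iff matrix_vector_mult_def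
      to_complex_sum to_complex_mult)

lemma complex_vec_add: "complex_vec (x + y) = complex_vec x + complex_vec y"
  by (simp add: complex_vec_def vec_eq_iff to_complex_add)

lemma inner_complex_vec: "complex_vec x \<bullet> complex_vec y = x \<bullet> y"
  by (simp only: inner_vec_def complex_vec_def vec_lambda_beta inner_to_complex)

lemma complex_vec_stack: "complex_vec (stack_vec x u) = stack_vec (complex_vec x) (complex_vec u)"
  for x :: "'k::real_or_complex^'n" and u :: "'k^'m"
  by (simp add: vec_eq_Plus_iff complex_vec_def)

lemma complex_mat_add: "complex_mat (X + Y) = complex_mat X + complex_mat Y"
  and complex_mat_diff: "complex_mat (X - Y) = complex_mat X - complex_mat Y"
  by (simp_all add: complex_mat_def vec_eq_iff to_complex_add to_complex_diff)

lemma complex_mat_mult: "complex_mat (X ** Y) = complex_mat X ** complex_mat Y"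
  by (simp add: complex_mat_def vec_eq_iff matrix_matrix_mult_def to_complex_sum to_complex_mult)

lemma complex_mat_ctranspose: "complex_mat (ctranspose X) = ctranspose (complex_mat X)"
  by (simp add: complex_mat_def ctranspose_def vec_eq_iff to_complex_conjg)

lemma complex_mat_block:
  "complex_mat (block_mat X11 X12 X21 X22)
    = block_mat (complex_mat X11) (complex_mat X12) (complex_mat X21) (complex_mat X22)"
  by (rule vec_eq_Plus_iff[THEN iffD2])
     (simp add: vec_eq_Plus_iff complex_mat_def block_mat_def stack_mat_def)

lemma hermitian_complex_mat: "hermitian M \<Longrightarrow> hermitian (complex_mat M)"
  by (simp add: hermitian_def flip: complex_mat_ctranspose)

lemma complex_mat_kyp_matrix:
  "complex_mat (kyp_matrix E A B Q S R P) = kyp_matrix (complex_mat E) (complex_mat A)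
    (complex_mat B) (complex_mat Q) (complex_mat S) (complex_mat R) (complex_mat P)"
  by (simp add: kyp_matrix_def complex_mat_block complex_mat_add complex_mat_diff complex_mat_mult
      complex_mat_ctranspose)

text \<open>A pair of coordinates of a complex number over the scalar field that serves both models: real
  and imaginary part over the reals, the number itself and \<open>0\<close> over the complex numbers. In either
  case the two summands are orthogonal as real vectors.\<close>

lemma scalar_coordinates:
  obtains p q :: "complex \<Rightarrow> 'k::real_or_complex" where
    "\<And>z. z = to_complex (p z) + \<i> * to_complex (q z)"
    "\<And>y z. p (y + z) = p y + p z" "\<And>y z. q (y + z) = q y + q z"
    "\<And>a z. p (to_complex a * z) = a * p z" "\<And>a z. q (to_complex a * z) = a * q z"
    "\<And>(a::'k) z. to_complex a \<bullet> (\<i> * to_complex (q z)) = 0"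
proof (cases "range (to_complex :: 'k \<Rightarrow> complex) = UNIV")
  case True
  define p where "p = inv (to_complex :: 'k \<Rightarrow> complex)"
  have p: "to_complex (p z) = z" for z
    using True by (simp add: p_def f_inv_into_f)
  show ?thesis
    by (rule that[of p "\<lambda>_. 0"])
       (simp_all add: p, (rule to_complex_eqI, simp add: p to_complex_add to_complex_mult)+)
next
  case False
  then have real: "to_complex a \<in> \<real>" for a :: 'k
    using range_to_complex[where 'k = 'k] by blast
  then have real_eq: "to_complex a = of_real (Re (to_complex a))" for a :: 'k
    by (simp add: of_real_Re)
  have Im: "Im (to_complex a) = 0" for a :: 'k
    using real by (simp add: complex_is_Real_iff)
  show ?thesis
  proof (rule that[of "\<lambda>z. of_real (Re z)" "\<lambda>z. of_real (Im z)"])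
    show "of_real (Re (to_complex a * z)) = a * of_real (Re z)"
      and "of_real (Im (to_complex a * z)) = a * of_real (Im z)" for a :: 'k and z
      by (rule to_complex_eqI, simp add: to_complex_mult to_complex_of_real Im complex_eq_iff)+
  qed (simp_all add: to_complex_of_real complex_eq[symmetric] inner_complex_def Im)
qed

definition coord :: "(complex \<Rightarrow> 'k) \<Rightarrow> complex^'n \<Rightarrow> 'k^'n" where
  "coord r v = (\<chi> i. r (v $ i))"

text \<open>Both coordinates of a complex trajectory are trajectories over the scalar field, and by
  orthogonality the form at \<open>p + \<i> q\<close> has no cross terms, that is, it is the sum of the forms at \<open>p\<close>
  and \<open>q\<close>.\<close>

lemma complex_behavior_nonneg:
  fixes E A :: "'k::real_or_complex^'n^'n" and B :: "'k^'m^'n" and M :: "'k^('n + 'm)^('n + 'm)"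
  assumes XU: "(X, U) \<in> behavior (complex_mat E) (complex_mat A) (complex_mat B)"
    and M: "\<And>v. v \<in> system_space E A B \<Longrightarrow> 0 \<le> v \<bullet> (M *v v)"
  shows "0 \<le> stack_vec (X 0) (U 0) \<bullet> (complex_mat M *v stack_vec (X 0) (U 0))"
proof -
  obtain p q :: "complex \<Rightarrow> 'k" where pq: "\<And>z. z = to_complex (p z) + \<i> * to_complex (q z)"
    and p: "\<And>y z. p (y + z) = p y + p z" "\<And>a z. p (to_complex a * z) = a * p z"
    and q: "\<And>y z. q (y + z) = q y + q z" "\<And>a z. q (to_complex a * z) = a * q z"
    and orth: "\<And>(a::'k) z. to_complex a \<bullet> (\<i> * to_complex (q z)) = 0"
    by (rule scalar_coordinates) blast
  have coord_add: "coord r (v + w) = coord r v + coord r w"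
    if "\<And>y z. r (y + z) = r y + r z" for r :: "complex \<Rightarrow> 'k" and v w :: "complex^'i"
    by (simp add: coord_def vec_eq_iff that)
  have coord_mult: "coord r (complex_mat N *v v) = N *v coord r v"
    if "\<And>y z. r (y + z) = r y + r z" "\<And>a z. r (to_complex a * z) = a * r z"
    for r and N :: "'k^'i^'l" and v
  proof -
    have "r 0 = 0" using that(1)[of 0 0] by simp
    then have "r (sum f I) = (\<Sum>i\<in>I. r (f i))" for f and I :: "'i set"
      by (induction I rule: infinite_finite_induct) (simp_all add: that)
    then show ?thesis
      by (simp add: coord_def vec_eq_iff matrix_vector_mult_def complex_mat_def that)
  qed
  have mem: "stack_vec (coord r (X 0)) (coord r (U 0)) \<in> system_space E A B"
    if r: "\<And>y z. r (y + z) = r y + r z" "\<And>a z. r (to_complex a * z) = a * r z" for r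
  proof -
    have "stack_vec (x 0) (u 0) \<in> system_space E A B" if "(x, u) \<in> behavior E A B" for x u
      unfolding system_space_def using that by (intro vec.span_base) blast
    moreover have "(\<lambda>j. coord r (X j), \<lambda>j. coord r (U j)) \<in> behavior E A B"
      using XU unfolding behavior_iff by (simp add: coord_mult[OF r, symmetric] coord_add[OF r(1), symmetric])
    ultimately show ?thesis
      by blast
  qed
  define v where "v = stack_vec (X 0) (U 0)"
  have stack: "coord r v = stack_vec (coord r (X 0)) (coord r (U 0))" for r
    by (simp add: coord_def v_def vec_eq_Plus_iff)
  have split: "w = complex_vec (coord p w) + \<i> *s complex_vec (coord q w)" for w :: "complex^('n + 'm)"
    using pq by (simp add: vec_eq_iff complex_vec_def coord_def)
  have cross: "complex_vec a \<bullet> (\<i> *s complex_vec (coord q w)) = 0" for a :: "'k^('n + 'm)" and w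
    by (simp add: inner_vec_def complex_vec_def coord_def orth)
  have eq: "complex_mat M *v v = complex_vec (M *v coord p v) + \<i> *s complex_vec (M *v coord q v)"
    by (subst split[of v])
       (simp add: matrix_vector_right_distrib matrix_mult_scale complex_mat_mult_vec)
  have "v \<bullet> (complex_mat M *v v) = (complex_vec (coord p v) + \<i> *s complex_vec (coord q v))
      \<bullet> (complex_vec (M *v coord p v) + \<i> *s complex_vec (M *v coord q v))"
    using eq split[of v] by simp
  also have "\<dots> = coord p v \<bullet> (M *v coord p v) + coord q v \<bullet> (M *v coord q v)"
    using cross[of "coord p v" "complex_mat M *v v"] cross[of "M *v coord p v" v]
    by (simp add: inner_add_left inner_add_right coord_mult[OF q] inner_scale_scale
        inner_complex_vec inner_commute[of "\<i> *s complex_vec (coord q v)"])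
  finally show ?thesis
    using M[OF mem[OF p]] M[OF mem[OF q]] unfolding v_def[symmetric] stack[symmetric] by simp
qed


section \<open>The Popov function on the unit circle\<close>

lemma map_poly_to_complex_mult:
  "map_poly to_complex (p * q) = map_poly to_complex p * map_poly to_complex q"
  by (rule poly_eqI) (simp add: coeff_map_poly coeff_mult to_complex_sum to_complex_mult)

lemma map_poly_to_complex_sum:
  "map_poly to_complex (sum f I) = (\<Sum>i\<in>I. map_poly to_complex (f i))"
  by (rule poly_eqI) (simp add: coeff_map_poly coeff_sum to_complex_sum)

lemma map_poly_to_complex_prod:
  "map_poly to_complex (prod f I) = (\<Prod>i\<in>I. map_poly to_complex (f i))"
  by (induction I rule: infinite_finite_induct)
     (simp_all add: map_poly_to_complex_mult to_complex_one map_poly_1)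

text \<open>The determinant of the pencil is a polynomial over the scalar field, which remains nonzero
  under the embedding of its coefficients.\<close>

lemma finite_pencil_eigenvalues:
  fixes E A :: "'k::real_or_complex^'n^'n"
  assumes "regular_pencil E A"
  shows "finite {z. det (pencil_at E A z) = 0}"
proof -
  define D where "D = det (\<chi> i j. [:- (A $ i $ j), E $ i $ j:])"
  have "to_complex (of_int k :: 'k) = of_int k" for k
    using to_complex_of_real[of "of_int k", where 'k = 'k] by simp
  then have sgn: "map_poly to_complex (of_int k :: 'k poly) = of_int k" for k
    by (simp add: of_int_poly map_poly_pCons)
  have "poly (map_poly to_complex D) z = det (pencil_at E A z)" for z
    unfolding D_def det_def map_poly_to_complex_sum map_poly_to_complex_mult sgn
      map_poly_to_complex_prod poly_sum poly_mult poly_prod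
    by (simp add: map_poly_pCons to_complex_minus pencil_at_def)
  moreover have "map_poly to_complex D \<noteq> 0"
  proof
    assume "map_poly to_complex D = 0"
    then have "to_complex (coeff D i) = to_complex (0::'k)" for i
      by (metis coeff_0 coeff_map_poly to_complex_zero)
    then have "D = 0"
      by (intro poly_eqI) (simp add: inj_to_complex[THEN injD])
    then show False
      using assms unfolding regular_pencil_def D_def[symmetric] by simp
  qed
  ultimately show ?thesis
    using poly_roots_finite[of "map_poly to_complex D"] by simp
qed

lemma pencil_at_mult: "pencil_at E A z *v x = z *s (complex_mat E *v x) - complex_mat A *v x"
  by (simp add: vec_eq_iff pencil_at_def matrix_vector_mult_def complex_mat_def left_diff_distrib
      sum_subtractf sum_distrib_left mult.assoc)

text \<open>On the unit circle \<open>1 / cnj z = z\<close>, so the para-adjoint is the adjoint.\<close>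

lemma popov_inner:
  assumes "norm z = 1"
  shows "u \<bullet> (popov E A B Q S R z *v w) = (state_input_transfer E A B z *v u) \<bullet>
    (complex_mat (block_mat Q S (ctranspose S) R) *v (state_input_transfer E A B z *v w))"
proof -
  have "z * cnj z = 1"
    using assms by (simp add: complex_norm_square[symmetric])
  then have "inverse (cnj z) = z"
    by (metis inverse_unique mult.commute)
  then show ?thesis
    unfolding popov_def para_adjoint_def matrix_vector_mul_assoc[symmetric]
    by (simp add: inner_commute[of u] inner_ctranspose)
       (simp add: inner_commute)
qed

lemma state_input_transfer_mult:
  assumes "det (pencil_at E A z) \<noteq> 0"
  shows "state_input_transfer E A B z *v u = stack_vec x u \<longleftrightarrow>
    complex_mat A *v x + complex_mat B *v u = z *s (complex_mat E *v x)"
proof -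
  have "invertible (pencil_at E A z)"
    using assms by (simp add: invertible_det_nz)
  then have inv: "pencil_at E A z ** matrix_inv (pencil_at E A z) = mat 1 \<and>
      matrix_inv (pencil_at E A z) ** pencil_at E A z = mat 1"
    unfolding invertible_def matrix_inv_def by (rule someI_ex)
  have "state_input_transfer E A B z *v u = stack_vec x u \<longleftrightarrow>
      matrix_inv (pencil_at E A z) *v (complex_mat B *v u) = x"
    by (simp add: state_input_transfer_def stack_mat_mult matrix_vector_mul_assoc vec_eq_Plus_iff)
       (simp add: vec_eq_iff)
  also have "\<dots> \<longleftrightarrow> complex_mat B *v u = pencil_at E A z *v x"
    using matrix_vector_mul_assoc[of "pencil_at E A z" "matrix_inv (pencil_at E A z)" "complex_mat B *v u"]
      matrix_vector_mul_assoc[of "matrix_inv (pencil_at E A z)" "pencil_at E A z" x] inv by auto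
  also have "\<dots> \<longleftrightarrow> complex_mat A *v x + complex_mat B *v u = z *s (complex_mat E *v x)"
    by (auto simp: pencil_at_mult algebra_simps)
  finally show ?thesis .
qed

text \<open>The vector \<open>(x, u)\<close> with \<open>x = (z E - A)\<^sup>-\<^sup>1 B u\<close> generates the complex trajectory
  \<open>z\<^sup>j (x, u)\<close>, along which the storage form of \<open>P\<close> does not change when \<open>|z| = 1\<close>.\<close>

theorem kyp_solution_imp_popov_psd:
  fixes E A Q P :: "'k::real_or_complex^'n^'n" and B S :: "'k^'m^'n"
  assumes QR: "hermitian Q" "hermitian R" and P: "kyp_solution E A B Q S R P"
    and z: "norm z = 1" "det (pencil_at E A z) \<noteq> 0"
  shows "psd (popov E A B Q S R z)"
proof -
  let ?W = "complex_mat (block_mat Q S (ctranspose S) R)"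
  have W: "v \<bullet> (?W *v w) = w \<bullet> (?W *v v)" for v w
    using hermitian_complex_mat[OF hermitian_weight[OF QR]] unfolding hermitian_iff_inner by blast
  have "0 \<le> u \<bullet> (popov E A B Q S R z *v u)" for u
  proof -
    obtain x u' where xu: "state_input_transfer E A B z *v u = stack_vec x u'"
      by (rule vec_as_stack)
    have "u' = u"
      using xu by (simp add: state_input_transfer_def stack_mat_mult vec_eq_Plus_iff) (simp add: vec_eq_iff)
    then have eq: "complex_mat A *v x + complex_mat B *v u = z *s (complex_mat E *v x)"
      using xu state_input_transfer_mult[OF z(2)] by blast
    have "(\<lambda>j. z ^ j *s x, \<lambda>j. z ^ j *s u) \<in> behavior (complex_mat E) (complex_mat A) (complex_mat B)"
      unfolding behavior_iff
      by (simp add: matrix_mult_scale vec.scale_right_distrib[symmetric] eq mult.commute)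
    from complex_behavior_nonneg[OF this]
    have "0 \<le> stack_vec x u \<bullet> (complex_mat (kyp_matrix E A B Q S R P) *v stack_vec x u)"
      using P psd_on_iff_inner[OF hermitian_kyp_matrix[OF _ QR], of P "system_space E A B" E A B S]
      by (simp add: kyp_solution_def system_space_def)
    also have "\<dots> = stack_vec x u \<bullet> (?W *v stack_vec x u)"
      unfolding complex_mat_kyp_matrix kyp_matrix_inner eq matrix_mult_scale inner_scale_scale
      by (simp add: z complex_mat_block complex_mat_ctranspose)
    finally show ?thesis
      using xu \<open>u' = u\<close> by (simp add: popov_inner z)
  qed
  moreover have "hermitian (popov E A B Q S R z)"
    unfolding hermitian_iff_inner popov_inner[OF z(1)] using W by blast
  ultimately show ?thesis
    by (simp add: psd_iff_inner)
qed


section \<open>Loops and the discrete Fourier transform\<close>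

text \<open>Off the diagonal this is the geometric sum of a nontrivial \<open>k\<close>-th root of unity.\<close>

lemma sum_rotated_roots_of_unity:
  fixes \<mu> :: complex
  assumes \<mu>: "\<mu> \<noteq> 0" and ij: "i < k" "j < k"
  defines "\<zeta> \<equiv> exp (2 * of_real pi * \<i> / of_nat k)"
  shows "(\<Sum>l<k. (\<mu> * \<zeta> ^ l) ^ j * inverse (\<mu> * \<zeta> ^ l) ^ i) = (if i = j then of_nat k else 0)"
proof -
  have \<zeta>: "\<zeta> \<noteq> 0" by (simp add: \<zeta>_def)
  have pow: "\<zeta> ^ n = exp (2 * of_real pi * \<i> * of_nat n / of_nat k)" for n
    by (simp add: \<zeta>_def exp_of_nat_mult[symmetric] mult_ac)
  have \<zeta>_k: "\<zeta> ^ k = 1"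
    using complex_root_unity_eq_1[of k k] ij by (simp add: pow)
  define r where "r = \<zeta> ^ j * inverse \<zeta> ^ i"
  have "r ^ k = (\<zeta> ^ k) ^ j * inverse (\<zeta> ^ k) ^ i"
    by (simp add: r_def power_mult_distrib power_inverse mult.commute flip: power_mult)
  then have r_k: "r ^ k = 1"
    by (simp add: \<zeta>_k)
  have "(\<mu> * \<zeta> ^ l) ^ j * inverse (\<mu> * \<zeta> ^ l) ^ i = \<mu> ^ j * inverse \<mu> ^ i * r ^ l" for l
    by (simp add: r_def power_mult_distrib inverse_mult_distrib power_inverse mult_ac flip: power_mult)
  then have sum: "(\<Sum>l<k. (\<mu> * \<zeta> ^ l) ^ j * inverse (\<mu> * \<zeta> ^ l) ^ i)
      = \<mu> ^ j * inverse \<mu> ^ i * (\<Sum>l<k. r ^ l)"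
    by (simp add: sum_distrib_left)
  show ?thesis
  proof (cases "i = j")
    case True
    then have "r = 1" "\<mu> ^ j * inverse \<mu> ^ i = 1"
      using \<mu> \<zeta> by (simp_all add: r_def power_inverse)
    then show ?thesis
      using True sum by simp
  next
    case False
    then have "\<zeta> ^ i \<noteq> \<zeta> ^ j"
      using complex_root_unity_eq[of k i j] ij by (simp add: pow)
    then have "r \<noteq> 1"
      using \<zeta> by (simp add: r_def power_inverse field_simps)
    then show ?thesis
      using False sum by (simp add: geometric_sum r_k)
  qed
qed

definition finite_transform :: "nat \<Rightarrow> (nat \<Rightarrow> complex^'n) \<Rightarrow> complex \<Rightarrow> complex^'n" where
  "finite_transform k v z = (\<Sum>j<k. inverse z ^ j *s v j)"

text \<open>Parseval's identity for the quadratic form of an arbitrary matrix.\<close>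

lemma parseval_rotated_roots_of_unity:
  fixes v :: "nat \<Rightarrow> complex^'n"
  assumes \<mu>: "norm \<mu> = 1"
  defines "\<zeta> \<equiv> \<lambda>k. exp (2 * of_real pi * \<i> / of_nat k)"
  shows "(\<Sum>l<k. finite_transform k v (\<mu> * \<zeta> k ^ l) \<bullet> (W *v finite_transform k v (\<mu> * \<zeta> k ^ l)))
    = real k * (\<Sum>j<k. v j \<bullet> (W *v v j))"
proof -
  define z where "z l = \<mu> * \<zeta> k ^ l" for l
  have "norm (\<zeta> k) = 1"
    by (simp add: \<zeta>_def norm_exp_eq_Re)
  then have "norm (z l) = 1" for l
    using \<mu> by (simp add: z_def norm_mult norm_power)
  then have "z l * cnj (z l) = 1" for l
    by (simp add: complex_norm_square[symmetric])
  then have cnj: "cnj (inverse (z l)) = z l" for l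
    by (metis complex_cnj_inverse inverse_unique mult.commute)
  have "finite_transform k v (z l) \<bullet> (W *v finite_transform k v (z l))
      = Re (\<Sum>j<k. \<Sum>i<k. z l ^ j * inverse (z l) ^ i * sesq (v j) (W *v v i))" for l
    unfolding inner_eq_Re_sesq finite_transform_def matrix_mult_sum sesq_sum_left
    unfolding sesq_sum_right matrix_mult_scale sesq_scale_left sesq_scale_right to_complex_complex conjg_complex
      complex_cnj_power cnj
    by (simp add: mult_ac)
  then have "(\<Sum>l<k. finite_transform k v (z l) \<bullet> (W *v finite_transform k v (z l)))
      = Re (\<Sum>l<k. \<Sum>j<k. \<Sum>i<k. z l ^ j * inverse (z l) ^ i * sesq (v j) (W *v v i))"
    by simp
  also have "(\<Sum>l<k. \<Sum>j<k. \<Sum>i<k. z l ^ j * inverse (z l) ^ i * sesq (v j) (W *v v i))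
      = (\<Sum>j<k. \<Sum>l<k. \<Sum>i<k. z l ^ j * inverse (z l) ^ i * sesq (v j) (W *v v i))"
    by (rule sum.swap)
  also have "\<dots> = (\<Sum>j<k. \<Sum>i<k. \<Sum>l<k. z l ^ j * inverse (z l) ^ i * sesq (v j) (W *v v i))"
    by (rule sum.cong[OF refl sum.swap])
  also have "\<dots> = (\<Sum>j<k. \<Sum>i<k. (\<Sum>l<k. z l ^ j * inverse (z l) ^ i) * sesq (v j) (W *v v i))"
    unfolding sum_distrib_right ..
  also have "\<dots> = (\<Sum>j<k. \<Sum>i<k. if i = j then of_nat k * sesq (v j) (W *v v i) else 0)"
  proof (intro sum.cong refl)
    fix i j assume "i \<in> {..<k}" "j \<in> {..<k}"
    then have "(\<Sum>l<k. z l ^ j * inverse (z l) ^ i) = (if i = j then of_nat k else 0)"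
      unfolding z_def \<zeta>_def using \<mu> by (intro sum_rotated_roots_of_unity) auto
    then show "(\<Sum>l<k. z l ^ j * inverse (z l) ^ i) * sesq (v j) (W *v v i)
        = (if i = j then of_nat k * sesq (v j) (W *v v i) else 0)"
      by simp
  qed
  also have "\<dots> = of_nat k * (\<Sum>j<k. sesq (v j) (W *v v j))"
    by (simp add: sum_distrib_left)
  finally show ?thesis
    by (simp add: z_def inner_eq_Re_sesq)
qed

text \<open>The transform of a trajectory that starts and ends at rest turns the shift into
  multiplication by \<open>z\<close>; rest at both ends means that no boundary terms remain.\<close>

lemma finite_transform_loop:
  assumes xu: "(x, u) \<in> behavior E A B" and loop: "E *v x 0 = 0" "E *v x k = 0" and z: "z \<noteq> 0"
  shows "A *v finite_transform k x z + B *v finite_transform k u z = z *s (E *v finite_transform k x z)"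
proof (cases k)
  case 0
  then show ?thesis by (simp add: finite_transform_def)
next
  case (Suc n)
  have "A *v finite_transform k x z + B *v finite_transform k u z
      = (\<Sum>j<k. inverse z ^ j *s (E *v x (Suc j)))"
    using xu unfolding behavior_iff finite_transform_def
    by (simp add: matrix_mult_sum matrix_mult_scale vec.scale_right_distrib flip: sum.distrib)
  also have "\<dots> = (\<Sum>j<n. inverse z ^ j *s (E *v x (Suc j)))"
    using loop by (simp add: Suc)
  also have "\<dots> = (\<Sum>j<n. z *s (inverse z ^ Suc j *s (E *v x (Suc j))))"
    using z by (intro sum.cong refl) (simp add: vec.scale_scale)
  also have "\<dots> = z *s (\<Sum>j<k. inverse z ^ j *s (E *v x j))"
    unfolding Suc sum.lessThan_Suc_shift using loop by (simp add: vec.scale_sum_right)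
  also have "\<dots> = z *s (E *v finite_transform k x z)"
    by (simp add: finite_transform_def matrix_mult_sum matrix_mult_scale)
  finally show ?thesis .
qed

text \<open>Parseval's identity expresses the supply of a loop by values of the Popov form at \<open>k\<close> equidistant
  points of the circle. The identity holds for every rotation \<open>\<mu>\<close> of these points, so \<open>\<mu>\<close> can be
  chosen such that they miss the finitely many eigenvalues of the pencil.\<close>

theorem popov_psd_imp_loop_nonneg:
  fixes E A Q :: "'k::real_or_complex^'n^'n" and B S :: "'k^'m^'n"
  assumes regular: "regular_pencil E A"
    and psd: "\<And>z. \<lbrakk>norm z = 1; det (pencil_at E A z) \<noteq> 0\<rbrakk> \<Longrightarrow> psd (popov E A B Q S R z)"
    and xu: "(x, u) \<in> behavior E A B" and loop: "E *v x 0 = 0" "E *v x k = 0"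
  shows "0 \<le> total_supply (block_mat Q S (ctranspose S) R) x u k"
proof (cases "k = 0")
  case True
  then show ?thesis by (simp add: total_supply_def)
next
  case False
  let ?W = "block_mat Q S (ctranspose S) R"
  define \<zeta> where "\<zeta> = exp (2 * of_real pi * \<i> / of_nat k)"
  have \<zeta>: "norm \<zeta> = 1"
    by (simp add: \<zeta>_def norm_exp_eq_Re)
  define Z where "Z = {z. det (pencil_at E A z) = 0}"
  have "finite (\<Union>l<k. (\<lambda>z. z / \<zeta> ^ l) ` Z)"
    using finite_pencil_eigenvalues[OF regular] by (simp add: Z_def)
  moreover have "infinite (sphere (0::complex) 1)"
  proof -
    have "1 \<in> sphere (0::complex) 1" "-1 \<in> sphere (0::complex) 1" "(1::complex) \<noteq> -1"
      by simp_all
    then have "\<not> (\<exists>a. sphere (0::complex) 1 = {a})"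
      by (metis singletonD)
    then show ?thesis
      using connected_finite_iff_sing[OF connected_sphere[of "0::complex" 1]] by auto
  qed
  ultimately obtain \<mu> where \<mu>: "norm \<mu> = 1" "\<mu> \<notin> (\<Union>l<k. (\<lambda>z. z / \<zeta> ^ l) ` Z)"
    by (metis finite_subset mem_sphere_0 subsetI)
  define z where "z l = \<mu> * \<zeta> ^ l" for l
  have z: "norm (z l) = 1" for l
    using \<mu>(1) \<zeta> by (simp add: z_def norm_mult norm_power)
  have det: "det (pencil_at E A (z l)) \<noteq> 0" if "l < k" for l
  proof
    assume "det (pencil_at E A (z l)) = 0"
    then have "z l / \<zeta> ^ l \<in> (\<Union>l<k. (\<lambda>z. z / \<zeta> ^ l) ` Z)"
      using that by (auto simp: Z_def)
    moreover have "\<zeta> \<noteq> 0"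
      using \<zeta> by auto
    ultimately show False
      using \<mu>(2) by (simp add: z_def)
  qed
  define v where "v j = complex_vec (stack_vec (x j) (u j))" for j
  have xu': "(\<lambda>j. complex_vec (x j), \<lambda>j. complex_vec (u j))
      \<in> behavior (complex_mat E) (complex_mat A) (complex_mat B)"
    using xu by (simp add: behavior_iff complex_mat_mult_vec flip: complex_vec_add)
  have "0 \<le> finite_transform k v (z l) \<bullet> (complex_mat ?W *v finite_transform k v (z l))" if l: "l < k" for l
  proof -
    let ?X = "finite_transform k (\<lambda>j. complex_vec (x j)) (z l)"
      and ?U = "finite_transform k (\<lambda>j. complex_vec (u j)) (z l)"
    have "z l \<noteq> 0"
      using z[of l] by auto
    then have "complex_mat A *v ?X + complex_mat B *v ?U = z l *s (complex_mat E *v ?X)"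
      using loop by (intro finite_transform_loop[OF xu']) (simp_all add: complex_mat_mult_vec)
    then have "state_input_transfer E A B (z l) *v ?U = stack_vec ?X ?U"
      using state_input_transfer_mult[OF det[OF l]] by blast
    also have "\<dots> = finite_transform k v (z l)"
      unfolding finite_transform_def v_def complex_vec_stack stack_vec_sum stack_vec_scale ..
    finally have transfer: "state_input_transfer E A B (z l) *v ?U = finite_transform k v (z l)" .
    have "0 \<le> ?U \<bullet> (popov E A B Q S R (z l) *v ?U)"
      using psd[OF z det[OF l]] unfolding psd_iff_inner by blast
    then show ?thesis
      unfolding popov_inner[OF z] transfer .
  qed
  then have "0 \<le> (\<Sum>l<k. finite_transform k v (z l) \<bullet> (complex_mat ?W *v finite_transform k v (z l)))"
    by (intro sum_nonneg) simp
  also have "\<dots> = real k * (\<Sum>j<k. v j \<bullet> (complex_mat ?W *v v j))"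
    unfolding z_def \<zeta>_def by (rule parseval_rotated_roots_of_unity[OF \<mu>(1)])
  also have "\<dots> = real k * total_supply ?W x u k"
    by (simp add: v_def complex_mat_mult_vec inner_complex_vec total_supply_def)
  finally show ?thesis
    using False by (simp add: zero_le_mult_iff)
qed

section \<open>The discrete-time KYP lemma\<close>

theorem theorem3p6:
  fixes E A :: "'k::real_or_complex^'n^'n" and B :: "'k^'m^'n"
    and Q :: "'k^'n^'n" and S :: "'k^'m^'n" and R :: "'k^'m^'m"
  assumes "(E, A, B, Q, S, R) \<in> weighted_systems"
  shows "((\<exists>P. kyp_solution E A B Q S R P) \<longrightarrow>
            (\<forall>\<omega>::real. det (pencil_at E A (exp (\<i> * of_real \<omega>))) \<noteq> 0 \<longrightarrow>
               psd (popov E A B Q S R (exp (\<i> * of_real \<omega>)))))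
       \<and> (R_controllable E A B \<and>
          (\<forall>\<omega>::real. det (pencil_at E A (exp (\<i> * of_real \<omega>))) \<noteq> 0 \<longrightarrow>
               psd (popov E A B Q S R (exp (\<i> * of_real \<omega>)))) \<longrightarrow>
            (\<exists>P. kyp_solution E A B Q S R P))"
proof -
  have regular: "regular_pencil E A" and QR: "hermitian Q" "hermitian R"
    using assms by (simp_all add: weighted_systems_def systems_def)
  have "psd (popov E A B Q S R (exp (\<i> * of_real \<omega>)))"
    if "kyp_solution E A B Q S R P" "det (pencil_at E A (exp (\<i> * of_real \<omega>))) \<noteq> 0" for P and \<omega> :: real
    using kyp_solution_imp_popov_psd[OF QR that(1) _ that(2)] by simp
  moreover have "\<exists>P. kyp_solution E A B Q S R P"
    if ctrl: "R_controllable E A B"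
      and psd: "\<forall>\<omega>::real. det (pencil_at E A (exp (\<i> * of_real \<omega>))) \<noteq> 0 \<longrightarrow>
        psd (popov E A B Q S R (exp (\<i> * of_real \<omega>)))"
  proof (rule controllable_dissipative_imp_kyp_solution[OF QR])
    have "psd (popov E A B Q S R z)" if "norm z = 1" "det (pencil_at E A z) \<noteq> 0" for z
      using psd that by (metis complex_norm_eq_1_exp)
    then show "controllable_dissipative E A B (block_mat Q S (ctranspose S) R)"
      by unfold_locales (use ctrl popov_psd_imp_loop_nonneg[OF regular] in \<open>blast+\<close>)
  qed
  ultimately show ?thesis by blast
qed

end
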